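(* Let $A$ be a Sturm-Liouville function, let $K=(\mathbb R_0,A(x)\,dx)$ be the associated Sturm-Liouville hypergroup, and suppose that $\rho:=\lim_{x\to\infty}\frac{A'(x)}{2A(x)}>0$. Let $\varphi_\lambda\in\widehat K$, where $\lambda\in\mathbb R_\rho=\mathbb R_0\cup i[0,\rho]$. Then $K$ is $\varphi_\lambda$-amenable if and only if $\lambda=i\rho$.
   Context: $\mathbb R_0=[0,\infty)$. A Sturm-Liouville function is a continuous function $A:\mathbb R_0\to\mathbb R$, positive and continuously differentiable on $\mathbb R_0\setminus\{0\}$, such that for all $x>0$ in a neighbourhood of $0$, $\frac{A'(x)}{A(x)}=\frac{\gamma_0}{x}+\gamma_1(x)$ with a constant $\gamma_0\ge 0$, and the following hold. (SL1) Either (SL1.1) $\gamma_0>0$ and $\gamma_1\in C^\infty(\mathbb R)$ is odd, or (SL1.2) $\gamma_0=0$ and $\gamma_1\in C^1(\mathbb R_0)$. (SL2) There exists $\eta\in C^1(\mathbb R_0)$ such that $\eta(0)\ge0$, $\frac{A'}{A}-\eta$ is nonnegative and decreasing on $\mathbb R_0\setminus\{0\}$, and $q:=\frac12\eta'-\frac14\eta^2+\frac{A'}{2A}\eta$ is decreasing on $\mathbb R_0\setminus\{0\}$. Put $\rho:=\lim_{x\to\infty}\frac{A'(x)}{2A(x)}$. For $\lambda\in\mathbb C$, $\varphi_\lambda$ is the solution on $\mathbb R_0$ of $$\Big(\frac{d^2}{dx^2}+\frac{A'(x)}{A(x)}\frac{d}{dx}\Big)\varphi_\lambda=-(\lambda^2+\rho^2)\varphi_\lambda,\quad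 \varphi_\lambda(0)=1,\ \varphi_\lambda'(0)=0.$$ The Sturm-Liouville hypergroup $(\mathbb R_0,A(x)dx)$ is the (unique) commutative hypergroup on $\mathbb R_0$ with Haar measure $A(x)dx$ determined by $A$: its characters are $\widehat K=\{\varphi_\lambda:\lambda\in\mathbb R_\rho\}$, where $\mathbb R_\rho:=\mathbb R_0\cup i[0,\rho]$, so its convolution $\omega(x,y)$ satisfies $\int\varphi_\lambda\,d\omega(x,y)=\varphi_\lambda(x)\varphi_\lambda(y)$. One has $\varphi_{i\rho}=1$. Translation is $T_xf(y)=\int_K f(t)\,d\omega(x,y)(t)$. For a commutative hypergroup $K$ and a character $\alpha\in\widehat K$, $K$ is called $\alpha$-amenable if there is a bounded linear functional $m_\alpha\in L^\infty(K)^*$ with $m_\alpha(\alpha)=1$ and $m_\alpha(T_xf)=\alpha(x)m_\alpha(f)$ for all $f\in L^\infty(K)$, $x\in K$. *)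

theory Defs
  imports "HOL-Probability.Probability" "HOL-Probability.Essential_Supremum"
begin

section \<open>Commutative hypergroups\<close>

text \<open>
  A hypergroup is carried by a locally compact subset \<open>K\<close> of a second countable Hausdorff space
  (so every Borel measure on \<open>K\<close> that is finite on compact sets is a Radon measure). Measures on
  \<open>K\<close> live on the sigma-algebra \<open>restrict_space borel K\<close>. The convolution is given by the probability
  measures \<open>\<omega> x y\<close>, the convolutions of the point masses at \<open>x\<close> and \<open>y\<close>; values of \<open>\<omega>\<close>, of the
  involution and of functions on \<open>K\<close> at points outside \<open>K\<close> are irrelevant everywhere below.
\<close>

definition msupport :: "'a::topological_space set \<Rightarrow> 'a measure \<Rightarrow> 'a set" where
  "msupport K \<mu> = {x \<in> K. \<forall>U. open U \<and> x \<in> U \<longrightarrow> emeasure \<mu> (U \<inter> K) \<noteq> 0}"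

definition translation :: "('a \<Rightarrow> 'a \<Rightarrow> 'a measure) \<Rightarrow> 'a \<Rightarrow> ('a \<Rightarrow> 'b) \<Rightarrow> 'a \<Rightarrow> 'b::{banach,second_countable_topology}"
  where "translation \<omega> x f y = (LINT t|\<omega> x y. f t)"

text \<open>
  The axioms of Jewett. Continuity of the convolution refers to the weak topology on probability
  measures. Associativity of the bilinear extension of \<open>\<omega>\<close> to bounded measures is stated on point
  masses and tested on bounded continuous functions. \<open>support_hit\<close> and \<open>support_inside\<close> say that
  \<open>(x, y) \<mapsto> msupport K (\<omega> x y)\<close> is continuous into the nonempty compact subsets of \<open>K\<close> with the
  Michael topology, whose subbasic open sets are the sets of all \<open>C\<close> meeting \<open>U\<close> and the sets of
  all \<open>C\<close> contained in \<open>U\<close>, for \<open>U\<close> open.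
\<close>

locale commutative_hypergroup =
  fixes K :: "'a::{second_countable_topology,t2_space} set"
    and \<omega> :: "'a \<Rightarrow> 'a \<Rightarrow> 'a measure"
    and e :: 'a
    and invo :: "'a \<Rightarrow> 'a"
  assumes locally_compact: "locally compact K"
    and prob: "\<lbrakk>x \<in> K; y \<in> K\<rbrakk> \<Longrightarrow> prob_space (\<omega> x y)"
    and sets_conv: "\<lbrakk>x \<in> K; y \<in> K\<rbrakk> \<Longrightarrow> sets (\<omega> x y) = sets (restrict_space borel K)"
    and conv_continuous: "\<And>f :: 'a \<Rightarrow> real. \<lbrakk>continuous_on K f; bounded (f ` K)\<rbrakk> \<Longrightarrow>
          continuous_on (K \<times> K) (\<lambda>(x, y). LINT t|\<omega> x y. f t)"
    and conv_assoc: "\<And>(f :: 'a \<Rightarrow> real) x y z.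
          \<lbrakk>continuous_on K f; bounded (f ` K); x \<in> K; y \<in> K; z \<in> K\<rbrakk> \<Longrightarrow>
          (LINT s|\<omega> y z. LINT t|\<omega> x s. f t) = (LINT s|\<omega> x y. LINT t|\<omega> s z. f t)"
    and conv_comm: "\<lbrakk>x \<in> K; y \<in> K\<rbrakk> \<Longrightarrow> \<omega> x y = \<omega> y x"
    and support_compact: "\<lbrakk>x \<in> K; y \<in> K\<rbrakk> \<Longrightarrow> compact (msupport K (\<omega> x y))"
    and support_hit: "open U \<Longrightarrow>
          openin (top_of_set (K \<times> K)) {(x, y) \<in> K \<times> K. msupport K (\<omega> x y) \<inter> U \<noteq> {}}"
    and support_inside: "open U \<Longrightarrow>
          openin (top_of_set (K \<times> K)) {(x, y) \<in> K \<times> K. msupport K (\<omega> x y) \<subseteq> U}"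
    and unit_in: "e \<in> K"
    and conv_unit: "x \<in> K \<Longrightarrow> \<omega> e x = return (restrict_space borel K) x"
    and inv_in: "x \<in> K \<Longrightarrow> invo x \<in> K"
    and inv_inv: "x \<in> K \<Longrightarrow> invo (invo x) = x"
    and inv_continuous: "continuous_on K invo"
    and conv_inv: "\<lbrakk>x \<in> K; y \<in> K\<rbrakk> \<Longrightarrow>
          distr (\<omega> x y) (restrict_space borel K) invo = \<omega> (invo y) (invo x)"
    and unit_in_support: "\<lbrakk>x \<in> K; y \<in> K\<rbrakk> \<Longrightarrow> e \<in> msupport K (\<omega> x (invo y)) \<longleftrightarrow> x = y"

definition hypergroup_haar ::
    "'a::topological_space set \<Rightarrow> ('a \<Rightarrow> 'a \<Rightarrow> 'a measure) \<Rightarrow> 'a measure \<Rightarrow> bool" where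
  "hypergroup_haar K \<omega> M \<longleftrightarrow>
     sets M = sets (restrict_space borel K) \<and>
     emeasure M K \<noteq> 0 \<and>
     (\<forall>C. compact C \<and> C \<subseteq> K \<longrightarrow> emeasure M C < \<infinity>) \<and>
     (\<forall>f :: 'a \<Rightarrow> real. \<forall>x\<in>K.
        continuous_on K f \<and> (\<exists>C. compact C \<and> C \<subseteq> K \<and> (\<forall>y\<in>K - C. f y = 0)) \<longrightarrow>
        (LINT y|M. translation \<omega> x f y) = (LINT y|M. f y))"

definition hypergroup_character ::
    "'a::topological_space set \<Rightarrow> ('a \<Rightarrow> 'a \<Rightarrow> 'a measure) \<Rightarrow> ('a \<Rightarrow> 'a) \<Rightarrow> ('a \<Rightarrow> complex) \<Rightarrow> bool" where
  "hypergroup_character K \<omega> invo \<alpha> \<longleftrightarrow>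
     continuous_on K \<alpha> \<and> bounded (\<alpha> ` K) \<and> (\<exists>x\<in>K. \<alpha> x \<noteq> 0) \<and>
     (\<forall>x\<in>K. \<forall>y\<in>K. (LINT t|\<omega> x y. \<alpha> t) = \<alpha> x * \<alpha> y) \<and>
     (\<forall>x\<in>K. \<alpha> (invo x) = cnj (\<alpha> x))"

definition Linf_norm :: "'a measure \<Rightarrow> ('a \<Rightarrow> complex) \<Rightarrow> ereal" where
  "Linf_norm M f = esssup M (\<lambda>x. ereal (cmod (f x)))"

definition Linf :: "'a measure \<Rightarrow> ('a \<Rightarrow> complex) set" where
  "Linf M = {f \<in> borel_measurable M. Linf_norm M f < \<infinity>}"

text \<open>
  The elements of \<open>Linf M\<close> are representatives rather than classes modulo null functions; the bound
  below forces a functional to agree on representatives that are equal almost everywhere, so these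
  are exactly the bounded linear functionals on the quotient space.
\<close>

definition Linf_functional :: "'a measure \<Rightarrow> (('a \<Rightarrow> complex) \<Rightarrow> complex) \<Rightarrow> bool" where
  "Linf_functional M m \<longleftrightarrow>
     (\<forall>f\<in>Linf M. \<forall>g\<in>Linf M. m (\<lambda>x. f x + g x) = m f + m g) \<and>
     (\<forall>c. \<forall>f\<in>Linf M. m (\<lambda>x. c * f x) = c * m f) \<and>
     (\<exists>C::real. \<forall>f\<in>Linf M. ereal (cmod (m f)) \<le> ereal C * Linf_norm M f)"

definition hypergroup_amenable ::
    "'a set \<Rightarrow> ('a \<Rightarrow> 'a \<Rightarrow> 'a measure) \<Rightarrow> 'a measure \<Rightarrow> ('a \<Rightarrow> complex) \<Rightarrow> bool" where
  "hypergroup_amenable K \<omega> M \<alpha> \<longleftrightarrow>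
     (\<exists>m. Linf_functional M m \<and> m \<alpha> = 1 \<and>
        (\<forall>f\<in>Linf M. \<forall>x\<in>K. m (translation \<omega> x f) = \<alpha> x * m f))"

section \<open>Sturm-Liouville functions and hypergroups\<close>

text \<open>\<open>C1_half f f'\<close>: \<open>f\<close> is of class C1 on the closed half-line with derivative \<open>f'\<close>, one-sided at 0.\<close>

definition C1_half :: "(real \<Rightarrow> real) \<Rightarrow> (real \<Rightarrow> real) \<Rightarrow> bool" where
  "C1_half f f' \<longleftrightarrow>
     continuous_on {0..} f' \<and> (\<forall>x\<ge>0. (f has_real_derivative f' x) (at x within {0..}))"

definition smooth_real :: "(real \<Rightarrow> real) \<Rightarrow> bool" where
  "smooth_real f \<longleftrightarrow> (\<forall>n x. (deriv ^^ n) f differentiable (at x))"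

definition SL1 :: "(real \<Rightarrow> real) \<Rightarrow> bool" where
  "SL1 A \<longleftrightarrow>
     (\<exists>\<gamma>0 \<gamma>1. \<gamma>0 \<ge> 0 \<and>
        eventually (\<lambda>x. deriv A x / A x = \<gamma>0 / x + \<gamma>1 x) (at_right 0) \<and>
        (\<gamma>0 > 0 \<and> smooth_real \<gamma>1 \<and> (\<forall>x. \<gamma>1 (- x) = - \<gamma>1 x) \<or>
         \<gamma>0 = 0 \<and> (\<exists>\<gamma>1'. C1_half \<gamma>1 \<gamma>1')))"

definition SL2 :: "(real \<Rightarrow> real) \<Rightarrow> bool" where
  "SL2 A \<longleftrightarrow>
     (\<exists>\<eta> \<eta>'. C1_half \<eta> \<eta>' \<and> \<eta> 0 \<ge> 0 \<and>
        (\<forall>x>0. deriv A x / A x - \<eta> x \<ge> 0) \<and>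
        antimono_on {0<..} (\<lambda>x. deriv A x / A x - \<eta> x) \<and>
        antimono_on {0<..} (\<lambda>x. \<eta>' x / 2 - (\<eta> x)\<^sup>2 / 4 + deriv A x / (2 * A x) * \<eta> x))"

definition sturm_liouville_function :: "(real \<Rightarrow> real) \<Rightarrow> bool" where
  "sturm_liouville_function A \<longleftrightarrow>
     continuous_on {0..} A \<and> (\<forall>x>0. A x > 0) \<and> A C1_differentiable_on {0<..} \<and> SL1 A \<and> SL2 A"

text \<open>
  \<open>sl_eigenfunction A \<rho> l \<phi>\<close>: on the closed half-line \<open>\<phi>\<close> is the solution with parameter \<open>l\<close> of the
  Sturm-Liouville initial value problem. The coefficient \<open>A'/A\<close> may be singular at 0, so the
  equation itself is required at \<open>x > 0\<close>; the derivative of \<open>\<phi>\<close> at 0 is one-sided.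
\<close>

definition sl_eigenfunction :: "(real \<Rightarrow> real) \<Rightarrow> real \<Rightarrow> complex \<Rightarrow> (real \<Rightarrow> complex) \<Rightarrow> bool" where
  "sl_eigenfunction A \<rho> l \<phi> \<longleftrightarrow>
     \<phi> 0 = 1 \<and>
     (\<exists>\<phi>' \<phi>''. \<phi>' 0 = 0 \<and>
        (\<forall>x\<ge>0. (\<phi> has_vector_derivative \<phi>' x) (at x within {0..})) \<and>
        (\<forall>x>0. (\<phi>' has_vector_derivative \<phi>'' x) (at x)) \<and>
        (\<forall>x>0. \<phi>'' x + of_real (deriv A x / A x) * \<phi>' x = - (l\<^sup>2 + of_real (\<rho>\<^sup>2)) * \<phi> x))"

definition sl_parameters :: "real \<Rightarrow> complex set" where
  "sl_parameters \<rho> = complex_of_real ` {0..} \<union> (\<lambda>t. \<i> * of_real t) ` {0..\<rho>}"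

definition sl_measure :: "(real \<Rightarrow> real) \<Rightarrow> real measure" where
  "sl_measure A = density (restrict_space lborel {0..}) (\<lambda>x. ennreal (A x))"

text \<open>
  \<open>\<omega>\<close> is the convolution of the Sturm-Liouville hypergroup of \<open>A\<close>, where \<open>\<rho>\<close> is the limit of
  \<open>A'/(2A)\<close> at infinity: the commutative hypergroup on the closed half-line with unit 0 and
  identical involution whose Haar measure is \<open>A(x) dx\<close> and whose characters are the functions
  \<open>\<phi>\<^sub>l\<close>, \<open>l \<in> sl_parameters \<rho>\<close>. Since the Fourier transform of measures is injective, the
  characters determine \<open>\<omega>\<close>.
\<close>

definition sturm_liouville_hypergroup ::
    "(real \<Rightarrow> real) \<Rightarrow> real \<Rightarrow> (real \<Rightarrow> real \<Rightarrow> real measure) \<Rightarrow> bool" where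
  "sturm_liouville_hypergroup A \<rho> \<omega> \<longleftrightarrow>
     commutative_hypergroup {0..} \<omega> 0 (\<lambda>x. x) \<and>
     hypergroup_haar {0..} \<omega> (sl_measure A) \<and>
     (\<forall>\<alpha>. hypergroup_character {0..} \<omega> (\<lambda>x. x) \<alpha> \<longleftrightarrow>
            (\<exists>l\<in>sl_parameters \<rho>. sl_eigenfunction A \<rho> l \<alpha>))"

end

(*
  Let q = A'/A. It is bounded below, and by rho > 0 it is bounded away from 0 near infinity.

  Only if: put s = l^2 + rho^2 and suppose s > 0. For t <> s close to s the eigenfunction psi with
  eigenvalue t is again a character, and invariance of a mean m for the character phi gives
  (psi(x) - phi(x)) m(psi) = 0 for all x, so m(psi) = 0 while m(phi) = 1. But w = phi - psi solves
  w'' + q w' + s w = (t - s) psi with |psi| <= 1 and w(0) = w'(0) = 0; the damping q makes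
  |w| <= C |t - s| on the whole half-line, which contradicts boundedness of m as t tends to s.

  If: for s = 0 the character is 1 and an invariant mean is needed. Since the convolution is
  commutative, averaging a probability density over convolution powers of finitely many point
  masses yields densities that are almost invariant under these points, and a cluster point of
  the corresponding functionals is invariant.
*)
theory Submission
  imports Defs
begin

section \<open>A priori bounds for the forced equation\<close>

text \<open>The functional \<open>m\<close> is controlled only by the supremum norm, so phi and psi
  must be close uniformly on the half-line; continuous dependence on the parameter over compact
  intervals would not do. Two regimes are glued: up to a fixed point only a lower bound of
  \<open>A'/A\<close> is at hand, since \<open>A'/A\<close> may blow up at 0, and an exponentially
  growing energy bound is good enough; beyond it the damping lies between positive bounds and a
  Lyapunov function keeps the solution at a level proportional to the forcing. That |psi| <= 1 is no
  fact about the equation: it holds because psi is bounded and multiplicative. The hypergroup turns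
  eigenfunctions into characters but supplies none, so psi has to be constructed.

  For the mean, functions are given only up to null sets, which point masses can charge. Hence the
  averaged measures are kept absolutely continuous with respect to the Haar measure, whose
  invariance preserves this under convolution. Commutativity is what lets a new point be treated
  without losing the points already treated.\<close>

text \<open>
  The left-hand side is the derivative of \<open>v\<^sup>2 + s u\<^sup>2 + 2 \<epsilon> u v\<close> along \<open>u' = v\<close>,
  \<open>v' = F - s u - p v\<close>; the cross term makes it decay in \<open>u\<close> too.
\<close>

lemma lyapunov_derivative_bound:
  fixes p Q r s \<epsilon> F u v d :: real
  assumes p: "r \<le> p" "p \<le> Q" and r: "r > 0" and s: "s > 0" and F: "\<bar>F\<bar> \<le> d"
    and e: "\<epsilon> > 0" "\<epsilon> * (1 + Q\<^sup>2 / s) \<le> r / 4"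
  shows "2 * v * (F - s * u - p * v) + s * (2 * u * v) + 2 * \<epsilon> * (v * v + u * (F - s * u - p * v))
      \<le> (2 / r + 2 * \<epsilon> / s) * d\<^sup>2 - \<epsilon> * (v\<^sup>2 + s * u\<^sup>2)"
proof -
  have Fd: "F\<^sup>2 \<le> d\<^sup>2" using F by (metis abs_ge_zero power2_abs power_mono)
  have "0 \<le> (v * r / 2 - F)\<^sup>2 * (2 / r)" using r by simp
  also have "\<dots> = r / 2 * v\<^sup>2 + 2 / r * F\<^sup>2 - 2 * v * F"
    using r by (simp add: power2_eq_square field_simps)
  finally have 1: "2 * v * F \<le> r / 2 * v\<^sup>2 + 2 / r * F\<^sup>2" by simp
  have "0 \<le> (u * s / 2 - F)\<^sup>2 * (2 / s)" using s by simp
  also have "\<dots> = s / 2 * u\<^sup>2 + 2 / s * F\<^sup>2 - 2 * u * F"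
    using s by (simp add: power2_eq_square field_simps)
  finally have 2: "2 * u * F \<le> s / 2 * u\<^sup>2 + 2 / s * F\<^sup>2" by simp
  have "0 \<le> (u * s / 2 + p * v)\<^sup>2 * (2 / s)" using s by simp
  also have "\<dots> = s / 2 * u\<^sup>2 + 2 / s * (p\<^sup>2 * v\<^sup>2) + 2 * p * u * v"
    using s by (simp add: power2_eq_square field_simps)
  finally have 3: "- (2 * p * u * v) \<le> s / 2 * u\<^sup>2 + 2 / s * (p\<^sup>2 * v\<^sup>2)" by simp
  have pQ: "p\<^sup>2 \<le> Q\<^sup>2" using p r by (intro power_mono) auto
  have 4: "2 / s * (p\<^sup>2 * v\<^sup>2) \<le> 2 / s * (Q\<^sup>2 * v\<^sup>2)"
    using pQ s by (intro mult_left_mono mult_right_mono) auto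
  have 5: "\<epsilon> * (2 * u * F - 2 * p * u * v - 2 * s * u\<^sup>2)
      \<le> \<epsilon> * (2 / s * d\<^sup>2 + 2 / s * (Q\<^sup>2 * v\<^sup>2) - s * u\<^sup>2)"
  proof (rule mult_left_mono)
    have "2 / s * F\<^sup>2 \<le> 2 / s * d\<^sup>2" using Fd s by (intro mult_left_mono) auto
    then show "2 * u * F - 2 * p * u * v - 2 * s * u\<^sup>2
        \<le> 2 / s * d\<^sup>2 + 2 / s * (Q\<^sup>2 * v\<^sup>2) - s * u\<^sup>2"
      using 2 3 4 by argo
  qed (use e in auto)
  have 6: "r * v\<^sup>2 \<le> p * v\<^sup>2" using p by (intro mult_right_mono) auto
  have 7: "\<epsilon> * (1 + Q\<^sup>2 / s) * v\<^sup>2 \<le> r / 4 * v\<^sup>2" using e by (intro mult_right_mono) auto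
  have 8: "2 / r * F\<^sup>2 \<le> 2 / r * d\<^sup>2" using Fd r by (intro mult_left_mono) auto
  have 9: "r * v\<^sup>2 \<ge> 0" using r by simp
  have ev: "\<epsilon> * v\<^sup>2 \<le> r / 4 * v\<^sup>2"
  proof (rule mult_right_mono)
    have "\<epsilon> * 1 \<le> \<epsilon> * (1 + Q\<^sup>2 / s)" using e s by (intro mult_left_mono) auto
    then show "\<epsilon> \<le> r / 4" using e(2) by linarith
  qed simp
  have "2 * v * (F - s * u - p * v) + s * (2 * u * v) + 2 * \<epsilon> * (v * v + u * (F - s * u - p * v))
     = 2 * v * F - 2 * (p * v\<^sup>2) + 2 * (\<epsilon> * v\<^sup>2) + \<epsilon> * (2 * u * F - 2 * p * u * v - 2 * s * u\<^sup>2)"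
    by (simp add: power2_eq_square algebra_simps)
  also have "\<dots> \<le> (r / 2 * v\<^sup>2 + 2 / r * d\<^sup>2) - 2 * (r * v\<^sup>2) + 2 * (\<epsilon> * v\<^sup>2)
      + \<epsilon> * (2 / s * d\<^sup>2 + 2 / s * (Q\<^sup>2 * v\<^sup>2) - s * u\<^sup>2)"
    using 1 5 6 8 by linarith
  also have "\<dots> = (2 / r + 2 * \<epsilon> / s) * d\<^sup>2 - 3 / 2 * (r * v\<^sup>2) + 2 * (\<epsilon> * (1 + Q\<^sup>2 / s) * v\<^sup>2) - \<epsilon> * (s * u\<^sup>2)"
    using s r by (simp add: field_simps)
  also have "\<dots> \<le> (2 / r + 2 * \<epsilon> / s) * d\<^sup>2 - \<epsilon> * v\<^sup>2 - \<epsilon> * (s * u\<^sup>2)"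
    using 7 9 ev by linarith
  finally show ?thesis by (simp add: algebra_simps)
qed

section \<open>Growth of \<open>A\<close> and solutions of the forced equation\<close>

text \<open>Only a lower bound is imposed on \<open>q = A'/A\<close>: near 0 this quotient may
  behave like \<open>\<gamma>0 / x\<close> with \<gamma>0 positive, which is unbounded
  above.\<close>

locale sl_coefficient =
  fixes A q :: "real \<Rightarrow> real" and c :: real
  assumes A_cont: "continuous_on {0..} A"
    and A_pos: "x > 0 \<Longrightarrow> A x > 0"
    and A_deriv: "x > 0 \<Longrightarrow> (A has_real_derivative q x * A x) (at x)"
    and q_ge: "x > 0 \<Longrightarrow> - c \<le> q x"
    and c_nonneg: "c \<ge> 0"
begin

text \<open>\<open>A\<close> may vanish at 0, so dividing an integral of \<open>A * f\<close> over
  \<open>{0..y}\<close> by \<open>A y\<close> is delicate. The lower bound on \<open>q\<close> makes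
  \<open>A x * exp (c * x)\<close> increasing, which bounds \<open>A\<close> at earlier points by
  its value at later ones.\<close>

lemma A_growth:
  assumes "0 \<le> t" "t \<le> x"
  shows "A t \<le> A x * exp (c * (x - t))"
proof -
  have "A t * exp (c * t) \<le> A x * exp (c * x)"
  proof (rule DERIV_nonneg_imp_increasing_open[OF assms(2)])
    show "continuous_on {t..x} (\<lambda>x. A x * exp (c * x))"
      by (intro continuous_intros continuous_on_subset[OF A_cont]) (use assms in auto)
    fix y assume y: "t < y" "y < x"
    then have "y > 0" using assms by auto
    have "((\<lambda>x. A x * exp (c * x)) has_real_derivative (q y + c) * (A y * exp (c * y))) (at y)"
      by (rule derivative_eq_intros A_deriv[OF \<open>y > 0\<close>] refl)+ (simp add: algebra_simps)
    moreover have "(q y + c) * (A y * exp (c * y)) \<ge> 0"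
      using q_ge[OF \<open>y > 0\<close>] A_pos[OF \<open>y > 0\<close>] by (intro mult_nonneg_nonneg) auto
    ultimately show "\<exists>z. ((\<lambda>x. A x * exp (c * x)) has_real_derivative z) (at y) \<and> z \<ge> 0"
      by blast
  qed
  then have "A t * exp (c * t) * exp (- (c * t)) \<le> A x * exp (c * x) * exp (- (c * t))"
    by (intro mult_right_mono) auto
  then show ?thesis
    by (simp add: mult.assoc flip: exp_add) (simp add: algebra_simps)
qed

lemma A_nonneg: "x \<ge> 0 \<Longrightarrow> A x \<ge> 0"
proof (cases "x = 0")
  case True
  have "(A \<longlongrightarrow> A 0) (at 0 within {0..})"
    using A_cont by (simp add: continuous_on_def)
  then have "(A \<longlongrightarrow> A 0) (at_right 0)"
    by (rule filterlim_mono) (auto intro: at_le)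
  then have "A 0 \<ge> 0"
    by (rule tendsto_lowerbound)
      (auto simp: eventually_at_right[of 0 1, simplified] intro!: exI[of _ 1] less_imp_le A_pos)
  then show ?thesis using True by simp
next
  case False
  assume "x \<ge> 0"
  then show ?thesis using A_pos[of x] False by auto
qed

lemma A_le:
  assumes "0 \<le> t" "t \<le> x"
  shows "A t \<le> A x * exp (c * x)"
proof -
  have "A t \<le> A x * exp (c * (x - t))" by (rule A_growth[OF assms])
  also have "\<dots> \<le> A x * exp (c * x)"
    using c_nonneg assms A_nonneg[of x] by (intro mult_left_mono) (auto intro!: mult_left_mono)
  finally show ?thesis .
qed

text \<open>
  \<open>u'\<close> need not be continuous at 0; that the boundary term of \<open>A u'\<close> vanishes there is seen along
  points produced by the mean value theorem for \<open>u\<close>.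
\<close>

lemma flux_bound:
  fixes u u' h :: "real \<Rightarrow> real"
  assumes u: "\<And>x. x \<ge> 0 \<Longrightarrow> (u has_real_derivative u' x) (at x within {0..})"
    and u0: "u' 0 = 0"
    and u': "\<And>x. x > 0 \<Longrightarrow> (u' has_real_derivative h x - q x * u' x) (at x)"
    and h: "\<And>t. 0 < t \<Longrightarrow> t \<le> x \<Longrightarrow> \<bar>h t\<bar> \<le> H"
    and x: "x \<ge> 0"
  shows "\<bar>u' x\<bar> \<le> H * x * exp (c * x)"
proof (cases "x = 0")
  case True then show ?thesis using u0 by simp
next
  case False
  then have x: "x > 0" using x by auto
  have H: "H \<ge> 0" using h[of x] x by auto
  have ua: "(u has_real_derivative u' y) (at y)" if "y > 0" for y
    using u[of y] that at_within_interior[of y "{0..}"] by (simp add: interior_real_atLeast)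
  have small: "\<exists>t. 0 < t \<and> t < x \<and> \<bar>u' t\<bar> \<le> e" if e: "e > 0" for e
  proof -
    have "((\<lambda>y. (u y - u 0) / (y - 0)) \<longlongrightarrow> 0) (at 0 within {0..})"
      using u[of 0] u0 by (simp add: has_field_derivative_iff)
    from tendstoD[OF this e] obtain d where d: "d > 0"
      "\<And>y. y \<ge> 0 \<Longrightarrow> y \<noteq> 0 \<Longrightarrow> \<bar>y\<bar> < d \<Longrightarrow> \<bar>(u y - u 0) / y\<bar> < e"
      by (auto simp: eventually_at dist_real_def)
    define y where "y = min d x / 2"
    have y: "y > 0" "y < d" "y < x" using d x by (auto simp: y_def)
    have "continuous_on {0..y} u"
      by (rule DERIV_continuous_on[where D=u'])
        (auto intro: has_field_derivative_subset[OF u])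
    from mvt[OF y(1) this, of "\<lambda>x h. u' x * h"] obtain t where t: "0 < t" "t < y" "u y - u 0 = u' t * (y - 0)"
      using ua by (auto simp: has_field_derivative_def mult_commute_abs)
    then have "u' t = (u y - u 0) / y" using y by simp
    with d(2)[of y] y have "\<bar>u' t\<bar> \<le> e" by simp
    with t y show ?thesis by (intro exI[of _ t]) auto
  qed
  have le: "\<bar>u' x\<bar> \<le> H * x * exp (c * x) + e" if e: "e > 0" for e
  proof -
    define e' where "e' = e * exp (- (c * x))"
    have e': "e' > 0" using e by (simp add: e'_def)
    from small[OF this] obtain t where t: "0 < t" "t < x" "\<bar>u' t\<bar> \<le> e'" by auto
    \<comment> \<open>In the derivative of \<open>A * u'\<close> the possibly singular terms with
      \<open>q\<close> cancel.\<close>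
    have D: "((\<lambda>x. A x * u' x) has_real_derivative A y * h y) (at y)" if "y > 0" for y
      by (rule derivative_eq_intros A_deriv[OF that] u'[OF that] refl)+ (simp add: algebra_simps)
    from MVT2[OF t(2), of "\<lambda>x. A x * u' x" "\<lambda>y. A y * h y"] obtain z where
      z: "t < z" "z < x" "A x * u' x - A t * u' t = (x - t) * (A z * h z)"
      using D t(1) by force
    have "\<bar>A x * u' x\<bar> \<le> \<bar>A t * u' t\<bar> + \<bar>(x - t) * (A z * h z)\<bar>"
      using z(3) by linarith
    also have "\<dots> = A t * \<bar>u' t\<bar> + (x - t) * (A z * \<bar>h z\<bar>)"
      using t z A_pos[of t] A_pos[of z] by (simp add: abs_mult)
    also have "\<dots> \<le> (A x * exp (c * x)) * e' + x * ((A x * exp (c * x)) * H)"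
      using t z A_le[of t x] A_le[of z x] h[of z] A_pos[of t] A_pos[of z] A_pos[of x] H
      by (intro add_mono mult_mono) (auto simp: zero_le_mult_iff)
    also have "\<dots> = A x * (H * x * exp (c * x) + e)"
      unfolding e'_def by (simp add: algebra_simps exp_minus)
    finally have "A x * \<bar>u' x\<bar> \<le> A x * (H * x * exp (c * x) + e)"
      using A_pos[OF x] by (simp add: abs_mult)
    then show ?thesis using A_pos[OF x] by (simp add: mult_le_cancel_left_pos)
  qed
  then show ?thesis by (rule field_le_epsilon)
qed

text \<open>The value at 0 is left free: eigenfunctions are the case \<open>F = 0\<close> with value
  1, and differences of two of them have value 0 and a small \<open>F\<close>.\<close>

definition forced_solution :: "real \<Rightarrow> (real \<Rightarrow> real) \<Rightarrow> (real \<Rightarrow> real) \<Rightarrow> (real \<Rightarrow> real) \<Rightarrow> bool" where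
  "forced_solution s F w w' \<longleftrightarrow>
     (\<forall>x\<ge>0. (w has_real_derivative w' x) (at x within {0..})) \<and> w' 0 = 0 \<and>
     (\<forall>x>0. (w' has_real_derivative F x - s * w x - q x * w' x) (at x))"

text \<open>A solution carries no continuity of \<open>w'\<close> at 0; it follows from
  \<open>flux_bound\<close>, whose right-hand side tends to 0 there. The energy argument needs it,
  because it compares with the initial values at 0.\<close>

lemma forced_solution_continuous:
  assumes "forced_solution s F w w'" "\<And>x. x > 0 \<Longrightarrow> \<bar>F x\<bar> \<le> d"
  shows "continuous_on {0..} w" "continuous_on {0..} w'"
proof -
  note sol = assms(1)[unfolded forced_solution_def]
  show w: "continuous_on {0..} w"
    by (rule DERIV_continuous_on[where D=w']) (use sol in auto)
  have "continuous_on {0..1} w"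
    by (rule continuous_on_subset[OF w]) auto
  then have "bounded (w ` {0..1})"
    by (intro compact_imp_bounded compact_continuous_image) auto
  then obtain B where B: "\<And>x. 0 \<le> x \<Longrightarrow> x \<le> 1 \<Longrightarrow> \<bar>w x\<bar> \<le> B"
    unfolding bounded_iff by force
  have bd: "\<bar>w' x\<bar> \<le> (d + \<bar>s\<bar> * B) * x * exp (c * x)" if "0 \<le> x" "x \<le> 1" for x
  proof (rule flux_bound[of w w' "\<lambda>x. F x - s * w x"])
    fix t assume t: "0 < t" "t \<le> x"
    have "\<bar>F t - s * w t\<bar> \<le> \<bar>F t\<bar> + \<bar>s * w t\<bar>" by linarith
    also have "\<dots> \<le> d + \<bar>s\<bar> * B"
      using assms(2)[of t] B[of t] t that by (auto simp: abs_mult intro!: add_mono mult_left_mono)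
    finally show "\<bar>F t - s * w t\<bar> \<le> d + \<bar>s\<bar> * B" .
  qed (use sol that in auto)
  have "(w' \<longlongrightarrow> w' 0) (at 0 within {0..})"
  proof -
    have "((\<lambda>x. (d + \<bar>s\<bar> * B) * x * exp (c * x)) \<longlongrightarrow> (d + \<bar>s\<bar> * B) * 0 * exp (c * 0)) (at 0 within {0..})"
      by (intro tendsto_intros)
    then have lim: "((\<lambda>x. (d + \<bar>s\<bar> * B) * x * exp (c * x)) \<longlongrightarrow> 0) (at 0 within {0..})"
      by (simp only: mult_zero_right mult_zero_left)
    have ev: "\<forall>\<^sub>F x in at 0 within {0..}. norm (w' x) \<le> (d + \<bar>s\<bar> * B) * x * exp (c * x)"
      unfolding eventually_at
    proof (intro exI[of _ 1] conjI ballI impI)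
      fix x :: real assume "x \<in> {0..}" "x \<noteq> 0 \<and> dist x 0 < 1"
      then have "0 \<le> x" "x \<le> 1" by (auto simp: dist_real_def)
      from bd[OF this] show "norm (w' x) \<le> (d + \<bar>s\<bar> * B) * x * exp (c * x)" by simp
    qed simp
    have "(w' \<longlongrightarrow> 0) (at 0 within {0..})"
      by (rule Lim_null_comparison[OF ev lim])
    then show ?thesis using sol by simp
  qed
  moreover have "(w' \<longlongrightarrow> w' x) (at x within {0..})" if x: "x > 0" for x
  proof -
    have "(w' has_real_derivative F x - s * w x - q x * w' x) (at x)"
      using sol x by blast
    then have "isCont w' x" by (rule DERIV_isCont)
    then show ?thesis
      unfolding isCont_def by (rule tendsto_within_subset) simp
  qed
  ultimately have "(w' \<longlongrightarrow> w' x) (at x within {0..})" if "x \<ge> 0" for x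
    using that by (cases "x = 0") auto
  then show "continuous_on {0..} w'"
    unfolding continuous_on_def by simp
qed

lemma forced_solution_DERIV:
  assumes "forced_solution s F w w'" "x > 0"
  shows "(w has_real_derivative w' x) (at x)"
    "(w' has_real_derivative F x - s * w x - q x * w' x) (at x)"
proof -
  have "at x within {0..} = at x"
    using assms(2) at_within_interior[of x "{0..}"] by (simp add: interior_real_atLeast)
  moreover have "(w has_real_derivative w' x) (at x within {0..})"
    using assms by (simp add: forced_solution_def)
  ultimately show "(w has_real_derivative w' x) (at x)" by simp
qed (use assms in \<open>simp add: forced_solution_def\<close>)

text \<open>The energy has derivative \<open>2 * w' * F - 2 * q * w'\<^sup>2\<close>, and
  \<open>q \<ge> - c\<close> bounds this by \<open>1 + 2 * c\<close> times the energy plus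
  \<open>d\<^sup>2\<close>: a Gronwall inequality. Its growth in \<open>x\<close> is harmless, as
  the bound serves only on a fixed bounded interval.\<close>

lemma energy_bound:
  assumes sol: "forced_solution s F w w'" and F: "\<And>x. x > 0 \<Longrightarrow> \<bar>F x\<bar> \<le> d"
    and w0: "w 0 = 0" and x: "x \<ge> 0" and s: "s \<ge> 0"
  shows "(w' x)\<^sup>2 + s * (w x)\<^sup>2 \<le> exp ((1 + 2 * c) * x) * d\<^sup>2"
proof -
  define k where "k = 1 + 2 * c"
  have k: "k \<ge> 1" using c_nonneg by (simp add: k_def)
  \<comment> \<open>The shift \<open>d\<^sup>2 / k\<close> absorbs the forcing, so that the weighted
    energy decreases from its value \<open>d\<^sup>2 / k\<close> at 0.\<close>
  let ?G = "\<lambda>x. exp (- k * x) * ((w' x)\<^sup>2 + s * (w x)\<^sup>2 + d\<^sup>2 / k)"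
  have "?G x \<le> ?G 0"
  proof (rule DERIV_nonpos_imp_decreasing_open[OF x])
    note cts = forced_solution_continuous[OF sol F]
    have "continuous_on {0..x} w" by (rule continuous_on_subset[OF cts(1)]) auto
    moreover have "continuous_on {0..x} w'" by (rule continuous_on_subset[OF cts(2)]) auto
    ultimately show "continuous_on {0..x} ?G"
      by (intro continuous_intros)
    fix y assume y: "0 < y" "y < x"
    note D = forced_solution_DERIV[OF sol y(1)]
    let ?E = "(2 * w' y * (F y - s * w y - q y * w' y) + s * (2 * w y * w' y))"
    have "(?G has_real_derivative exp (- k * y) * (?E - k * ((w' y)\<^sup>2 + s * (w y)\<^sup>2 + d\<^sup>2 / k))) (at y)"
      by (rule derivative_eq_intros D refl)+ (simp add: algebra_simps)
    moreover have "?E - k * ((w' y)\<^sup>2 + s * (w y)\<^sup>2 + d\<^sup>2 / k) \<le> 0"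
    proof -
      have "(w' y - F y)\<^sup>2 \<ge> 0" by simp
      then have 1: "2 * w' y * F y \<le> (w' y)\<^sup>2 + (F y)\<^sup>2" by (simp add: power2_diff)
      have 2: "(F y)\<^sup>2 \<le> d\<^sup>2" using F[OF y(1)] by (metis abs_ge_zero power2_abs power_mono)
      have 3: "- q y * (w' y)\<^sup>2 \<le> c * (w' y)\<^sup>2"
        using q_ge[OF y(1)] by (intro mult_right_mono) auto
      have 4: "k * (s * (w y)\<^sup>2) \<ge> 0" using k s by simp
      have 5: "k * (d\<^sup>2 / k) = d\<^sup>2" using k by simp
      have "?E = 2 * w' y * F y - 2 * (q y * (w' y)\<^sup>2)"
        by (simp add: algebra_simps power2_eq_square)
      also have "\<dots> \<le> (w' y)\<^sup>2 + d\<^sup>2 + 2 * (c * (w' y)\<^sup>2)" using 1 2 3 by linarith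
      also have "\<dots> = k * (w' y)\<^sup>2 + d\<^sup>2" by (simp add: k_def algebra_simps)
      finally show ?thesis using 4 5 by (simp add: distrib_left)
    qed
    ultimately show "\<exists>z. (?G has_real_derivative z) (at y) \<and> z \<le> 0"
      by (intro exI conjI) (auto simp: mult_nonneg_nonpos)
  qed
  moreover have "w' 0 = 0" using sol by (simp add: forced_solution_def)
  ultimately have "exp (- (k * x)) * ((w' x)\<^sup>2 + s * (w x)\<^sup>2 + d\<^sup>2 / k) \<le> d\<^sup>2 / k"
    by (simp add: w0)
  then have "exp (k * x) * (exp (- (k * x)) * ((w' x)\<^sup>2 + s * (w x)\<^sup>2 + d\<^sup>2 / k)) \<le> exp (k * x) * (d\<^sup>2 / k)"
    by (intro mult_left_mono) auto
  then have "(w' x)\<^sup>2 + s * (w x)\<^sup>2 + d\<^sup>2 / k \<le> exp (k * x) * (d\<^sup>2 / k)"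
    by (simp add: mult.assoc[symmetric] flip: exp_add)
  moreover have "d\<^sup>2 / k \<ge> 0" using k by simp
  moreover have "exp (k * x) * (d\<^sup>2 / k) \<le> exp (k * x) * d\<^sup>2"
    using k mult_right_mono[of 1 k "d\<^sup>2"] by (intro mult_left_mono) (auto simp: field_simps)
  ultimately show ?thesis unfolding k_def by linarith
qed

text \<open>\<open>C\<close> is fixed before \<open>F\<close>, \<open>w\<close> and
  \<open>d\<close>, and the bound is linear in \<open>d\<close> on the whole half-line; this is what
  compares two eigenfunctions in the supremum norm.\<close>

lemma forced_bound:
  assumes s: "s > 0" and r: "r > 0" and q: "(q \<longlongrightarrow> 2 * r) at_top"
  obtains C where "C > 0"
    "\<And>F w w' d x. forced_solution s F w w' \<Longrightarrow> (\<And>x. x > 0 \<Longrightarrow> \<bar>F x\<bar> \<le> d) \<Longrightarrow> w 0 = 0 \<Longrightarrow>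
       x \<ge> 0 \<Longrightarrow> d \<ge> 0 \<Longrightarrow> \<bar>w x\<bar> \<le> C * d"
proof -
  have "\<forall>\<^sub>F x in at_top. \<bar>q x - 2 * r\<bar> < r"
    using tendstoD[OF q r] by (simp add: dist_real_def)
  then obtain R0 where R0: "\<And>x. x \<ge> R0 \<Longrightarrow> \<bar>q x - 2 * r\<bar> < r"
    by (auto simp: eventually_at_top_linorder)
  define R where "R = max R0 1"
  have R: "R > 0" and Rq: "\<And>x. x \<ge> R \<Longrightarrow> r \<le> q x \<and> q x \<le> 3 * r"
  proof -
    show "R > 0" by (simp add: R_def)
    fix x assume "x \<ge> R"
    then have "\<bar>q x - 2 * r\<bar> < r" by (intro R0) (simp add: R_def)
    then show "r \<le> q x \<and> q x \<le> 3 * r" by linarith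
  qed
  define Q where "Q = 3 * r"
  \<comment> \<open>The first bound is the hypothesis of \<open>lyapunov_derivative_bound\<close>.
    The second keeps the cross term below half of the energy, so that \<open>?V\<close> lies between
    one half and twice the energy.\<close>
  define \<epsilon> where "\<epsilon> = min (r / 4 / (1 + Q\<^sup>2 / s)) (sqrt s / 2)"
  have pos: "1 + Q\<^sup>2 / s > 0" using s by (intro add_pos_nonneg) auto
  have e: "\<epsilon> > 0" using pos r s by (simp add: \<epsilon>_def)
  have "\<epsilon> * (1 + Q\<^sup>2 / s) \<le> r / 4 / (1 + Q\<^sup>2 / s) * (1 + Q\<^sup>2 / s)"
    using pos by (intro mult_right_mono) (auto simp: \<epsilon>_def)
  also have "\<dots> = r / 4" using pos by (metis nonzero_divide_eq_eq less_irrefl)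
  finally have e1: "\<epsilon> * (1 + Q\<^sup>2 / s) \<le> r / 4" .
  have "\<epsilon>\<^sup>2 \<le> (sqrt s / 2)\<^sup>2"
    using e by (intro power_mono) (simp_all only: \<epsilon>_def min.cobounded2 less_imp_le)
  then have e2: "\<epsilon>\<^sup>2 \<le> s / 4" using s by (simp add: power_divide)
  define k where "k = exp ((1 + 2 * c) * R)"
  define D where "D = 2 / r + 2 * \<epsilon> / s"
  have D: "D > 0" using r s e by (auto simp: D_def intro!: add_pos_pos)
  have k: "k > 0" by (simp add: k_def)
  \<comment> \<open>Past \<open>R\<close> the Lyapunov function stays below
    \<open>2 * k * d\<^sup>2\<close> from its value at \<open>R\<close> plus the equilibrium level
    \<open>2 * D * d\<^sup>2 / \<epsilon>\<close>, and it dominates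
    \<open>s / 2 * w\<^sup>2\<close>; the constant also covers the bound \<open>k / s\<close> valid
    up to \<open>R\<close>.\<close>
  define C2 where "C2 = 2 / s * (2 * k + 2 * D / \<epsilon>)"
  have C2: "C2 > 0" unfolding C2_def using s k D e
    by (intro mult_pos_pos add_pos_pos divide_pos_pos) simp_all
  have main: "(w x)\<^sup>2 \<le> C2 * d\<^sup>2"
    if sol: "forced_solution s F w w'" and F: "\<And>x. x > 0 \<Longrightarrow> \<bar>F x\<bar> \<le> d" and w0: "w 0 = 0"
      and x: "x \<ge> 0" and d: "d \<ge> 0" for F w w' d x
  proof (cases "x \<le> R")
    case True
    have "s * (w x)\<^sup>2 \<le> (w' x)\<^sup>2 + s * (w x)\<^sup>2" by simp
    also have "\<dots> \<le> exp ((1 + 2 * c) * x) * d\<^sup>2"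
      by (rule energy_bound[OF sol F w0 x]) (use s in auto)
    also have "\<dots> \<le> k * d\<^sup>2"
      unfolding k_def using True c_nonneg by (intro mult_right_mono) auto
    finally have "(w x)\<^sup>2 \<le> k / s * d\<^sup>2" using s by (simp add: field_simps)
    also have "\<dots> \<le> C2 * d\<^sup>2"
      using s k D e by (intro mult_right_mono) (auto simp: C2_def field_simps)
    finally show ?thesis .
  next
    case False
    let ?V = "\<lambda>x. (w' x)\<^sup>2 + s * (w x)\<^sup>2 + 2 * \<epsilon> * (w x * w' x)"
    have Vb: "\<bar>2 * \<epsilon> * (w x * w' x)\<bar> \<le> s / 2 * (w x)\<^sup>2 + (w' x)\<^sup>2 / 2" for x
    proof -
      have "0 \<le> (2 * \<epsilon> * w x - w' x)\<^sup>2" "0 \<le> (2 * \<epsilon> * w x + w' x)\<^sup>2" by simp_all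
      then have "\<bar>4 * \<epsilon> * (w x * w' x)\<bar> \<le> 4 * \<epsilon>\<^sup>2 * (w x)\<^sup>2 + (w' x)\<^sup>2"
        by (simp add: power2_eq_square abs_le_iff algebra_simps)
      moreover have "\<epsilon>\<^sup>2 * (w x)\<^sup>2 \<le> s / 4 * (w x)\<^sup>2"
        using e2 by (intro mult_right_mono) auto
      ultimately show ?thesis by simp
    qed
    \<comment> \<open>Since \<open>?V\<close> is at most twice the energy, its derivative is at most
      \<open>D * d\<^sup>2 - \<epsilon> / 2 * ?V\<close>; hence the excess of \<open>?V\<close> over
      \<open>2 * D * d\<^sup>2 / \<epsilon>\<close> decays at rate
      \<open>\<epsilon> / 2\<close>.\<close>
    let ?W = "\<lambda>x. exp (\<epsilon> / 2 * x) * (?V x - 2 * D * d\<^sup>2 / \<epsilon>)"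
    have "?W x \<le> ?W R"
    proof (rule DERIV_nonpos_imp_nonincreasing[of R x ?W])
      show "R \<le> x" using False by simp
      fix y assume y: "R \<le> y" "y \<le> x"
      then have y0: "y > 0" using R by simp
      note DD = forced_solution_DERIV[OF sol y0]
      let ?E = "2 * w' y * (F y - s * w y - q y * w' y) + s * (2 * w y * w' y)
         + 2 * \<epsilon> * (w' y * w' y + w y * (F y - s * w y - q y * w' y))"
      have "(?W has_real_derivative exp (\<epsilon> / 2 * y) * (?E + \<epsilon> / 2 * (?V y - 2 * D * d\<^sup>2 / \<epsilon>))) (at y)"
        by (rule derivative_eq_intros DD refl)+ (simp add: algebra_simps)
      moreover have "?E + \<epsilon> / 2 * (?V y - 2 * D * d\<^sup>2 / \<epsilon>) \<le> 0"
      proof -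
        have "?E \<le> D * d\<^sup>2 - \<epsilon> * ((w' y)\<^sup>2 + s * (w y)\<^sup>2)"
          unfolding D_def using lyapunov_derivative_bound[of r "q y" Q s "F y" d \<epsilon> "w' y" "w y"] Rq[OF y(1)] r s F[OF y0] e e1
          by (simp add: Q_def)
        moreover have "\<epsilon> / 2 * ?V y \<le> \<epsilon> / 2 * (2 * ((w' y)\<^sup>2 + s * (w y)\<^sup>2))"
          using Vb[of y] e s by (intro mult_left_mono) auto
        moreover have "\<epsilon> / 2 * (2 * D * d\<^sup>2 / \<epsilon>) = D * d\<^sup>2" using e by simp
        ultimately show ?thesis unfolding right_diff_distrib by linarith
      qed
      ultimately show "\<exists>z. (?W has_real_derivative z) (at y) \<and> z \<le> 0"
        by - (rule exI, rule conjI, assumption, rule mult_nonneg_nonpos, rule exp_ge_zero, assumption)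
    qed
    then have "?V x - 2 * D * d\<^sup>2 / \<epsilon> \<le> exp (\<epsilon> / 2 * R) * (?V R - 2 * D * d\<^sup>2 / \<epsilon>) * exp (- (\<epsilon> / 2 * x))"
    proof -
      have "?V x - 2 * D * d\<^sup>2 / \<epsilon> = ?W x * exp (- (\<epsilon> / 2 * x))"
        by (simp add: mult.assoc mult.commute[of _ "exp (- _)"])
           (simp add: mult.assoc[symmetric] flip: exp_add)
      also have "\<dots> \<le> ?W R * exp (- (\<epsilon> / 2 * x))"
        using \<open>?W x \<le> ?W R\<close> by (intro mult_right_mono) auto
      finally show ?thesis .
    qed
    also have "\<dots> \<le> exp (\<epsilon> / 2 * R) * ?V R * exp (- (\<epsilon> / 2 * x))"
      using D e d by (intro mult_right_mono mult_left_mono) auto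
    also have "\<dots> = exp (- (\<epsilon> / 2 * (x - R))) * ?V R"
    proof -
      have "exp (\<epsilon> / 2 * R) * exp (- (\<epsilon> / 2 * x)) = exp (- (\<epsilon> / 2 * (x - R)))"
        by (simp add: diff_divide_distrib algebra_simps flip: exp_add)
      then show ?thesis by (simp only: mult.commute[of "exp (\<epsilon> / 2 * R)"] mult.assoc) (simp only: mult.commute)
    qed
    also have "\<dots> \<le> 1 * ?V R"
    proof (rule mult_right_mono)
      show "exp (- (\<epsilon> / 2 * (x - R))) \<le> 1" using False e by simp
      have "s / 2 * (w R)\<^sup>2 \<ge> 0" using s by simp
      then show "0 \<le> ?V R" using abs_ge_minus_self[of "2 * \<epsilon> * (w R * w' R)"] Vb[of R]
        by (simp add: add_divide_distrib)
    qed
    also have "\<dots> \<le> 2 * ((w' R)\<^sup>2 + s * (w R)\<^sup>2)"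
    proof -
      have "s / 2 * (w R)\<^sup>2 \<ge> 0" using s by simp
      then show ?thesis using abs_ge_self[of "2 * \<epsilon> * (w R * w' R)"] Vb[of R] zero_le_power2[of "w' R"]
        by argo
    qed
    also have "\<dots> \<le> 2 * (k * d\<^sup>2)"
      using energy_bound[OF sol F w0, of R] R s by (simp add: k_def)
    finally have "?V x \<le> (2 * k + 2 * D / \<epsilon>) * d\<^sup>2" by (simp add: algebra_simps)
    moreover have "s / 2 * (w x)\<^sup>2 \<le> ?V x" using abs_ge_minus_self[of "2 * \<epsilon> * (w x * w' x)"] Vb[of x] zero_le_power2[of "w' x"] by argo
    ultimately have "s / 2 * (w x)\<^sup>2 \<le> (2 * k + 2 * D / \<epsilon>) * d\<^sup>2" by linarith
    then have "2 / s * (s / 2 * (w x)\<^sup>2) \<le> 2 / s * ((2 * k + 2 * D / \<epsilon>) * d\<^sup>2)"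
      using s by (intro mult_left_mono) auto
    moreover have "2 / s * (s / 2 * (w x)\<^sup>2) = (w x)\<^sup>2" using s by simp
    ultimately show ?thesis unfolding C2_def by (simp only: mult.assoc)
  qed
  show ?thesis
  proof (rule that[of "sqrt C2"])
    show "sqrt C2 > 0" using C2 by simp
    fix F w w' :: "real \<Rightarrow> real" and d x :: real
    assume *: "forced_solution s F w w'" "\<And>x. x > 0 \<Longrightarrow> \<bar>F x\<bar> \<le> d" "w 0 = 0" "x \<ge> 0" "d \<ge> 0"
    have "(w x)\<^sup>2 \<le> C2 * d\<^sup>2" by (rule main[OF *])
    then have "sqrt ((w x)\<^sup>2) \<le> sqrt (C2 * d\<^sup>2)" by (rule real_sqrt_le_mono)
    then show "\<bar>w x\<bar> \<le> sqrt C2 * d" using *(5) by (simp add: real_sqrt_mult)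
  qed
qed

subsection \<open>Existence of eigenfunctions\<close>

text \<open>\<open>sl_inverse f\<close> is the solution of \<open>(A u')' = A f\<close> with \<open>u 0 = u' 0 = 0\<close>, and \<open>flux f\<close> is \<open>u'\<close>.\<close>

definition flux :: "(real \<Rightarrow> real) \<Rightarrow> real \<Rightarrow> real" where
  "flux f y = (if y > 0 then integral {0..y} (\<lambda>t. A t * f t) / A y else 0)"

definition sl_inverse :: "(real \<Rightarrow> real) \<Rightarrow> real \<Rightarrow> real" where
  "sl_inverse f x = integral {0..x} (flux f)"

lemma flux_le:
  assumes f: "continuous_on {0..} f" and B: "\<And>t. 0 \<le> t \<Longrightarrow> t \<le> y \<Longrightarrow> \<bar>f t\<bar> \<le> B" and y: "y \<ge> 0"
  shows "\<bar>flux f y\<bar> \<le> B * y * exp (c * y)"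
proof (cases "y = 0")
  case False
  then have y: "y > 0" using y by simp
  have "norm (integral {0..y} (\<lambda>t. A t * f t)) \<le> (A y * exp (c * y) * B) * (y - 0)"
  proof (rule integral_bound)
    show "continuous_on {0..y} (\<lambda>t. A t * f t)"
      by (intro continuous_intros continuous_on_subset[OF A_cont] continuous_on_subset[OF f]) auto
    show "norm (A t * f t) \<le> A y * exp (c * y) * B" if "t \<in> {0..y}" for t
      unfolding real_norm_def abs_mult using that A_le[of t y] B[of t] A_nonneg[of t] A_pos[OF y]
      by (intro mult_mono) auto
  qed (use y in auto)
  also have "\<dots> = (B * y * exp (c * y)) * A y" by simp
  finally show ?thesis using y A_pos[OF y] by (simp add: flux_def pos_divide_le_eq)
qed (simp add: flux_def)

lemma flux_DERIV:
  assumes f: "continuous_on {0..} f" and x: "x > 0"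
  shows "(flux f has_real_derivative f x - q x * flux f x) (at x)"
proof -
  let ?I = "\<lambda>y. integral {0..y} (\<lambda>t. A t * f t)"
  have "(?I has_real_derivative A x * f x) (at x within {0..x + 1})"
    by (rule integral_has_real_derivative)
      (use x in \<open>auto intro!: continuous_intros continuous_on_subset[OF A_cont] continuous_on_subset[OF f]\<close>)
  then have I: "(?I has_real_derivative A x * f x) (at x)"
    using x at_within_interior[of x "{0..x + 1}"] by simp
  have "((\<lambda>y. ?I y / A y) has_real_derivative f x - q x * (?I x / A x)) (at x)"
    by (rule derivative_eq_intros I A_deriv[OF x] refl)+
      (use A_pos[OF x] in \<open>simp_all add: field_simps power2_eq_square\<close>)
  then have "((\<lambda>y. ?I y / A y) has_real_derivative f x - q x * flux f x) (at x)"
    using x by (simp add: flux_def)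
  then show ?thesis
    by (rule DERIV_cong_ev[THEN iffD1, rotated -1])
      (use x eventually_gt_at_top in \<open>auto simp: flux_def eventually_nhds intro!: exI[of _ "{0<..}"]\<close>)
qed

lemma continuous_flux:
  assumes f: "continuous_on {0..} f"
  shows "continuous_on {0..} (flux f)"
proof -
  have "continuous_on {0..1} f"
    by (rule continuous_on_subset[OF f]) auto
  then have "bounded (f ` {0..1})"
    by (intro compact_imp_bounded compact_continuous_image) auto
  then obtain B where B: "\<And>x. 0 \<le> x \<Longrightarrow> x \<le> 1 \<Longrightarrow> \<bar>f x\<bar> \<le> B"
    unfolding bounded_iff by force
  have "((\<lambda>x. B * x * exp (c * x)) \<longlongrightarrow> B * 0 * exp (c * 0)) (at 0 within {0..})"
    by (intro tendsto_intros)
  then have lim: "((\<lambda>x. B * x * exp (c * x)) \<longlongrightarrow> 0) (at 0 within {0..})"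
    by (simp only: mult_zero_right mult_zero_left)
  have ev: "\<forall>\<^sub>F x in at 0 within {0..}. norm (flux f x) \<le> B * x * exp (c * x)"
    unfolding eventually_at
  proof (intro exI[of _ 1] conjI ballI impI)
    fix x :: real assume "x \<in> {0..}" "x \<noteq> 0 \<and> dist x 0 < 1"
    then have "0 \<le> x" "x \<le> 1" by (auto simp: dist_real_def)
    with flux_le[OF f, of x B] B show "norm (flux f x) \<le> B * x * exp (c * x)" by simp
  qed simp
  have "(flux f \<longlongrightarrow> 0) (at 0 within {0..})"
    by (rule Lim_null_comparison[OF ev lim])
  moreover have "(flux f \<longlongrightarrow> flux f x) (at x within {0..})" if x: "x > 0" for x
  proof -
    have "isCont (flux f) x" by (rule DERIV_isCont[OF flux_DERIV[OF f x]])
    then show ?thesis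
      unfolding isCont_def by (rule tendsto_within_subset) simp
  qed
  ultimately have "(flux f \<longlongrightarrow> flux f x) (at x within {0..})" if "x \<ge> 0" for x
    using that by (cases "x = 0") (auto simp: flux_def)
  then show ?thesis unfolding continuous_on_def by simp
qed

lemma sl_inverse_deriv:
  assumes f: "continuous_on {0..} f" and x: "x \<ge> 0"
  shows "(sl_inverse f has_real_derivative flux f x) (at x within {0..})"
proof -
  have "((\<lambda>x. integral {0..x} (flux f)) has_real_derivative flux f x) (at x within {0..x + 1})"
    by (rule integral_has_real_derivative)
      (use x in \<open>auto intro!: continuous_on_subset[OF continuous_flux[OF f]]\<close>)
  moreover have "at x within {0..x + 1} = at x within {0..}"
    by (rule at_within_nhd[of _ "{..<x + 1}"]) auto
  ultimately show ?thesis by (simp add: sl_inverse_def[abs_def])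
qed

lemma continuous_sl_inverse:
  "continuous_on {0..} f \<Longrightarrow> continuous_on {0..} (sl_inverse f)"
  by (rule DERIV_continuous_on[where D="flux f"]) (auto intro: sl_inverse_deriv)

lemma sl_inverse_diff:
  assumes f: "continuous_on {0..} f" and g: "continuous_on {0..} g" and x: "x \<ge> 0"
  shows "sl_inverse (\<lambda>t. f t - g t) x = sl_inverse f x - sl_inverse g x"
proof -
  have *: "(\<lambda>t. A t * h t) integrable_on {0..y}" if "continuous_on {0..} h" for h y
    by (intro integrable_continuous_real continuous_intros continuous_on_subset[OF A_cont]
        continuous_on_subset[OF that]) auto
  have "flux (\<lambda>t. f t - g t) = (\<lambda>y. flux f y - flux g y)"
    using *[OF f] *[OF g] by (auto simp: flux_def fun_eq_iff right_diff_distrib integral_diff diff_divide_distrib)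
  moreover have "flux h integrable_on {0..x}" if "continuous_on {0..} h" for h
    by (intro integrable_continuous_real continuous_on_subset[OF continuous_flux[OF that]]) auto
  ultimately show ?thesis using f g by (simp add: sl_inverse_def integral_diff)
qed

text \<open>
  Chosen with \<open>majorant' x \<ge> x * exp (c * x)\<close>, the factor in \<open>flux_le\<close>, so that each application
  of \<open>sl_inverse\<close> raises the exponent and divides by it.
\<close>

definition majorant :: "real \<Rightarrow> real" where "majorant x = x\<^sup>2 * exp (c * x)"

lemma majorant_mono: "0 \<le> t \<Longrightarrow> t \<le> x \<Longrightarrow> majorant t \<le> majorant x"
  unfolding majorant_def using c_nonneg by (intro mult_mono power_mono) (auto intro: mult_left_mono)

lemma majorant_nonneg: "majorant x \<ge> 0"
  by (simp add: majorant_def)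

lemma sl_inverse_le:
  assumes f: "continuous_on {0..} f" and x: "x \<ge> 0" and K: "K \<ge> 0"
    and le: "\<And>t. 0 \<le> t \<Longrightarrow> t \<le> x \<Longrightarrow> \<bar>f t\<bar> \<le> K * majorant t ^ n"
  shows "\<bar>sl_inverse f x\<bar> \<le> K * majorant x ^ Suc n / Suc n"
proof -
  have fl: "\<bar>flux f y\<bar> \<le> K * majorant y ^ n * y * exp (c * y)" if y: "0 \<le> y" "y \<le> x" for y
  proof (rule flux_le[OF f _ y(1)])
    fix t assume t: "0 \<le> t" "t \<le> y"
    have "\<bar>f t\<bar> \<le> K * majorant t ^ n" using le t y by auto
    also have "\<dots> \<le> K * majorant y ^ n"
      using t K by (intro mult_left_mono power_mono majorant_mono majorant_nonneg) auto
    finally show "\<bar>f t\<bar> \<le> K * majorant y ^ n" .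
  qed
  have D: "((\<lambda>x. K * majorant x ^ Suc n / Suc n) has_real_derivative
      K * majorant y ^ n * (2 * y * exp (c * y) + y\<^sup>2 * (c * exp (c * y)))) (at y)" for y
  proof -
    have "(majorant has_real_derivative 2 * y * exp (c * y) + y\<^sup>2 * (c * exp (c * y))) (at y)"
      unfolding majorant_def[abs_def] by (rule derivative_eq_intros refl)+ simp
    note DERIV_cdivide[OF DERIV_cmult[OF DERIV_power[OF this, of "Suc n"], of K], of "Suc n"]
    then show ?thesis by (rule DERIV_cong) (simp del: of_nat_Suc)
  qed
  have sl: "(sl_inverse f has_real_derivative flux f y) (at y)" if "y > 0" for y
    using sl_inverse_deriv[OF f, of y] that at_within_interior[of y "{0..}"]
    by (simp add: interior_real_atLeast)
  have le': "\<bar>flux f y\<bar> \<le> K * majorant y ^ n * (2 * y * exp (c * y) + y\<^sup>2 * (c * exp (c * y)))"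
    if y: "0 < y" "y < x" for y
  proof -
    have "y * exp (c * y) \<ge> 0" "y\<^sup>2 * (c * exp (c * y)) \<ge> 0" using c_nonneg y by auto
    then have "y * exp (c * y) \<le> 2 * y * exp (c * y) + y\<^sup>2 * (c * exp (c * y))" by linarith
    then have "K * majorant y ^ n * (y * exp (c * y)) \<le> K * majorant y ^ n * (2 * y * exp (c * y) + y\<^sup>2 * (c * exp (c * y)))"
      using K majorant_nonneg by (intro mult_left_mono) auto
    with fl[of y] y show ?thesis by simp
  qed
  have c: "continuous_on {0..x} (sl_inverse f)" "continuous_on {0..x} (\<lambda>x. K * majorant x ^ Suc n / Suc n)"
     apply (rule continuous_on_subset[OF continuous_sl_inverse[OF f]], force)
    unfolding majorant_def by (intro continuous_intros) auto
  have z: "sl_inverse f 0 = 0" "K * majorant 0 ^ Suc n / Suc n = 0"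
    by (simp_all add: sl_inverse_def majorant_def)
  \<comment> \<open>The derivative of the majorant term dominates |flux f|, so both its difference
    and its sum with \<open>sl_inverse f\<close> increase from the value 0.\<close>
  have "K * majorant 0 ^ Suc n / Suc n - sl_inverse f 0 \<le> K * majorant x ^ Suc n / Suc n - sl_inverse f x"
  proof (rule DERIV_nonneg_imp_increasing_open[OF x])
    fix y assume y: "0 < y" "y < x"
    show "\<exists>z. ((\<lambda>x. K * majorant x ^ Suc n / Suc n - sl_inverse f x) has_real_derivative z) (at y) \<and> 0 \<le> z"
      by (intro exI conjI, rule DERIV_diff[OF D sl[OF y(1)]]) (use le'[OF y] in linarith)
  qed (intro continuous_on_diff c)
  moreover have "K * majorant 0 ^ Suc n / Suc n + sl_inverse f 0 \<le> K * majorant x ^ Suc n / Suc n + sl_inverse f x"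
  proof (rule DERIV_nonneg_imp_increasing_open[OF x])
    fix y assume y: "0 < y" "y < x"
    show "\<exists>z. ((\<lambda>x. K * majorant x ^ Suc n / Suc n + sl_inverse f x) has_real_derivative z) (at y) \<and> 0 \<le> z"
      by (intro exI conjI, rule DERIV_add[OF D sl[OF y(1)]]) (use le'[OF y] in linarith)
  qed (intro continuous_on_add c)
  ultimately show ?thesis unfolding z by linarith
qed

text \<open>Fixed-point iteration for \<open>v = 1 - s * sl_inverse v\<close>, the integrated form
  of \<open>(A v')' = - s A v\<close> with \<open>v 0 = 1\<close> and
  \<open>v' 0 = 0\<close>.\<close>

primrec picard :: "real \<Rightarrow> nat \<Rightarrow> real \<Rightarrow> real" where
  "picard s 0 = (\<lambda>x. 1)"
| "picard s (Suc n) = (\<lambda>x. 1 - s * sl_inverse (picard s n) x)"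

lemma continuous_picard: "continuous_on {0..} (picard s n)"
  by (induction n) (auto intro!: continuous_intros continuous_sl_inverse)

text \<open>By linearity each step applies \<open>- s * sl_inverse\<close> to the previous
  difference; the divisions by the exponent accumulate to the factorial, which gives convergence for
  every \<open>s\<close>.\<close>

lemma picard_step:
  assumes "x \<ge> 0"
  shows "\<bar>picard s (Suc n) x - picard s n x\<bar> \<le> \<bar>s\<bar> ^ Suc n / fact (Suc n) * majorant x ^ Suc n"
  using assms
proof (induction n arbitrary: x)
  case 0
  have "\<bar>sl_inverse (\<lambda>x. 1) x\<bar> \<le> 1 * majorant x ^ Suc 0 / Suc 0"
    by (rule sl_inverse_le) (use 0 in auto)
  then show ?case using mult_left_mono[of _ _ "\<bar>s\<bar>"] by (simp add: abs_mult)
next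
  case (Suc n)
  have "picard s (Suc (Suc n)) x - picard s (Suc n) x
      = - s * sl_inverse (\<lambda>t. picard s (Suc n) t - picard s n t) x"
    using Suc.prems by (subst sl_inverse_diff) (auto intro!: continuous_picard simp: algebra_simps simp del: picard.simps, simp add: algebra_simps)
  then have "\<bar>picard s (Suc (Suc n)) x - picard s (Suc n) x\<bar>
      = \<bar>s\<bar> * \<bar>sl_inverse (\<lambda>t. picard s (Suc n) t - picard s n t) x\<bar>"
    by (simp only: abs_mult abs_minus_cancel)
  also have "\<dots> \<le> \<bar>s\<bar> * (\<bar>s\<bar> ^ Suc n / fact (Suc n) * majorant x ^ Suc (Suc n) / Suc (Suc n))"
    by (intro mult_left_mono sl_inverse_le continuous_intros continuous_picard Suc.prems Suc.IH) auto
  also have "\<dots> = \<bar>s\<bar> ^ Suc (Suc n) / fact (Suc (Suc n)) * majorant x ^ Suc (Suc n)"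
    by (simp add: field_simps)
  finally show ?case .
qed

lemma picard_limit:
  obtains v where "\<And>X. X \<ge> 0 \<Longrightarrow> uniform_limit {0..X} (picard s) v sequentially"
proof
  \<comment> \<open>The telescoping series is formed before an interval is chosen, so a single
    \<open>v\<close> serves all \<open>X\<close>.\<close>
  define v where "v x = 1 + (\<Sum>n. picard s (Suc n) x - picard s n x)" for x
  fix X :: real assume X: "X \<ge> 0"
  have "uniform_limit {0..X} (\<lambda>N x. \<Sum>n<N. picard s (Suc n) x - picard s n x)
     (\<lambda>x. \<Sum>n. picard s (Suc n) x - picard s n x) sequentially"
  proof (rule Weierstrass_m_test)
    show "summable (\<lambda>n. (\<bar>s\<bar> * majorant X) ^ Suc n / fact (Suc n))"
      using summable_exp[of "\<bar>s\<bar> * majorant X"]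
      by (subst summable_Suc_iff) (simp add: divide_inverse mult.commute)
    fix n x assume x: "x \<in> {0..X}"
    have "\<bar>picard s (Suc n) x - picard s n x\<bar> \<le> \<bar>s\<bar> ^ Suc n / fact (Suc n) * majorant x ^ Suc n"
      using x by (intro picard_step) auto
    also have "\<dots> \<le> \<bar>s\<bar> ^ Suc n / fact (Suc n) * majorant X ^ Suc n"
      using x by (intro mult_left_mono power_mono majorant_mono majorant_nonneg) auto
    finally show "norm (picard s (Suc n) x - picard s n x) \<le> (\<bar>s\<bar> * majorant X) ^ Suc n / fact (Suc n)"
      by (simp add: power_mult_distrib del: picard.simps power_Suc fact_Suc)
  qed
  then have "uniform_limit {0..X} (\<lambda>N x. 1 + (\<Sum>n<N. picard s (Suc n) x - picard s n x)) v sequentially"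
    unfolding v_def by (intro uniform_limit_intros)
  moreover have "1 + (\<Sum>n<N. picard s (Suc n) x - picard s n x) = picard s N x" for N x
    by (subst sum_lessThan_telescope) simp
  ultimately show "uniform_limit {0..X} (picard s) v sequentially"
    by (simp del: picard.simps)
qed

text \<open>Supplies the eigenfunction of a perturbed eigenvalue. The integral equation survives the
  limit because \<open>sl_inverse\<close> at \<open>x\<close> depends continuously on its argument
  in the supremum norm over \<open>{0..x}\<close>.\<close>

lemma eigenfunction_exists:
  obtains v where "continuous_on {0..} v" "v 0 = 1" "forced_solution s (\<lambda>x. 0) v (\<lambda>x. - s * flux v x)"
proof -
  obtain v where lim: "\<And>X. X \<ge> 0 \<Longrightarrow> uniform_limit {0..X} (picard s) v sequentially"
    by (rule picard_limit[of s]) blast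
  have ptw: "(\<lambda>n. picard s n x) \<longlonglongrightarrow> v x" if "x \<ge> 0" for x
    by (rule tendsto_uniform_limitI[OF lim[OF that]]) (use that in auto)
  have cX: "continuous_on {0..X} v" if "X \<ge> 0" for X
    by (rule uniform_limit_theorem[OF _ lim[OF that]])
      (auto intro!: always_eventually continuous_on_subset[OF continuous_picard])
  have cont: "continuous_on {0..} v"
    unfolding continuous_on_def
  proof
    fix x :: real assume x: "x \<in> {0..}"
    have "(v \<longlongrightarrow> v x) (at x within {0..x + 1})"
      using cX[of "x + 1"] x unfolding continuous_on_def by auto
    moreover have "at x within {0..x + 1} = at x within {0..}"
      by (rule at_within_nhd[of _ "{..<x + 1}"]) auto
    ultimately show "(v \<longlongrightarrow> v x) (at x within {0..})" by simp
  qed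
  have eq: "v x = 1 - s * sl_inverse v x" if x: "x \<ge> 0" for x
  proof (rule LIMSEQ_unique)
    show "(\<lambda>n. picard s (Suc n) x) \<longlonglongrightarrow> v x"
      using ptw[OF x] by (rule LIMSEQ_Suc)
    have "(\<lambda>n. sl_inverse (picard s n) x) \<longlonglongrightarrow> sl_inverse v x"
    proof (rule LIMSEQ_I)
      fix r :: real assume r: "r > 0"
      \<comment> \<open>An error \<open>e\<close> in the argument becomes at most
        \<open>e * majorant x\<close>; the added 1 covers \<open>majorant x = 0\<close>.\<close>
      define e where "e = r / (majorant x + 1)"
      have e: "e > 0" using r majorant_nonneg[of x] by (simp add: e_def add_nonneg_pos)
      obtain N where N: "\<And>n t. n \<ge> N \<Longrightarrow> 0 \<le> t \<Longrightarrow> t \<le> x \<Longrightarrow> dist (picard s n t) (v t) < e"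
        using lim[OF x] e unfolding uniform_limit_iff eventually_sequentially by fastforce
      have "norm (sl_inverse (picard s n) x - sl_inverse v x) < r" if n: "n \<ge> N" for n
      proof -
        have "\<bar>sl_inverse (\<lambda>t. picard s n t - v t) x\<bar> \<le> e * majorant x ^ Suc 0 / Suc 0"
          by (rule sl_inverse_le)
            (use N[OF n] x e in \<open>auto simp: dist_real_def intro!: continuous_intros continuous_picard cont less_imp_le\<close>)
        also have "\<dots> < e * (majorant x + 1)" using e by simp
        also have "\<dots> = r" using majorant_nonneg[of x] by (simp add: e_def)
        finally show ?thesis
          using sl_inverse_diff[OF continuous_picard cont x] by simp
      qed
      then show "\<exists>N. \<forall>n\<ge>N. norm (sl_inverse (picard s n) x - sl_inverse v x) < r" by blast
    qed
    then show "(\<lambda>n. picard s (Suc n) x) \<longlonglongrightarrow> 1 - s * sl_inverse v x"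
      by (simp, intro tendsto_intros)
  qed
  show ?thesis
  proof (rule that[OF cont])
    show "v 0 = 1" using eq[of 0] by (simp add: sl_inverse_def)
    show "forced_solution s (\<lambda>x. 0) v (\<lambda>x. - s * flux v x)"
      unfolding forced_solution_def
    proof (intro conjI allI impI)
      fix x :: real assume x: "x \<ge> 0"
      have "((\<lambda>x. 1 - s * sl_inverse v x) has_real_derivative - s * flux v x) (at x within {0..})"
        by (rule derivative_eq_intros sl_inverse_deriv[OF cont x] refl)+ simp
      then show "(v has_real_derivative - s * flux v x) (at x within {0..})"
        unfolding has_field_derivative_def by (rule has_derivative_transform[rotated 2]) (use x eq in auto)
    next
      fix x :: real assume x: "x > 0"
      show "((\<lambda>x. - s * flux v x) has_real_derivative 0 - s * v x - q x * (- s * flux v x)) (at x)"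
        by (rule derivative_eq_intros flux_DERIV[OF cont x] refl)+ (simp add: algebra_simps)
    qed (simp add: flux_def)
  qed
qed

end

section \<open>Characters other than 1 are not amenable\<close>

text \<open>SL2 places \<open>A'/A\<close> above a function continuous up to 0, hence above a
  constant on bounded intervals, whatever the singularity at 0; near infinity \<open>A'/A\<close> is
  positive because \<rho> is.\<close>

lemma sl_coefficient_exists:
  assumes A: "sturm_liouville_function A"
    and lim: "((\<lambda>x. deriv A x / (2 * A x)) \<longlongrightarrow> \<rho>) at_top" and \<rho>: "\<rho> > 0"
  obtains c where "sl_coefficient A (\<lambda>x. deriv A x / A x) c"
proof -
  from A have cont: "continuous_on {0..} A" and pos: "\<And>x. x > 0 \<Longrightarrow> A x > 0"
    and C1: "A C1_differentiable_on {0<..}" and SL2: "SL2 A"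
    by (auto simp: sturm_liouville_function_def)
  from C1 obtain D where D: "\<And>x. x > 0 \<Longrightarrow> (A has_vector_derivative D x) (at x)"
    by (auto simp: C1_differentiable_on_def)
  have der: "(A has_real_derivative deriv A x) (at x)" if "x > 0" for x
    using D[OF that] by (metis DERIV_imp_deriv has_real_derivative_iff_has_vector_derivative)
  from SL2 obtain \<eta> \<eta>' where eta: "C1_half \<eta> \<eta>'" and ge: "\<And>x. x > 0 \<Longrightarrow> deriv A x / A x \<ge> \<eta> x"
    unfolding SL2_def by force
  have "continuous_on {0..} \<eta>"
    by (rule DERIV_continuous_on[where D=\<eta>']) (use eta in \<open>auto simp: C1_half_def\<close>)
  have "\<forall>\<^sub>F x in at_top. deriv A x / (2 * A x) > 0"
    by (rule order_tendstoD(1)[OF lim \<rho>])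
  then obtain R where R: "\<And>x. x \<ge> R \<Longrightarrow> deriv A x / (2 * A x) > 0"
    by (auto simp: eventually_at_top_linorder)
  have "continuous_on {0..max R 0} \<eta>"
    by (rule continuous_on_subset[OF \<open>continuous_on {0..} \<eta>\<close>]) auto
  then have "bounded (\<eta> ` {0..max R 0})"
    by (intro compact_imp_bounded compact_continuous_image) auto
  then obtain B where B: "\<And>x. 0 \<le> x \<Longrightarrow> x \<le> max R 0 \<Longrightarrow> \<bar>\<eta> x\<bar> \<le> B"
    unfolding bounded_iff by force
  have "B \<ge> 0" using B[of 0] by auto
  have "- B \<le> deriv A x / A x" if x: "x > 0" for x
  proof (cases "x \<le> max R 0")
    case True
    then show ?thesis using B[OF less_imp_le[OF x] True] ge[OF x] by linarith
  next
    case False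
    then have "deriv A x / (2 * A x) > 0" by (intro R) auto
    then have "deriv A x / A x > 0" using pos[OF x] by (simp add: zero_less_divide_iff)
    then show ?thesis using \<open>B \<ge> 0\<close> by linarith
  qed
  then have "sl_coefficient A (\<lambda>x. deriv A x / A x) B"
    using cont pos der \<open>B \<ge> 0\<close> by unfold_locales (auto simp: less_imp_neq[THEN not_sym])
  then show ?thesis by (rule that)
qed

text \<open>The eigenvalue is \<open>a\<^sup>2 + \<rho>\<^sup>2\<close> on the real branch and
  \<open>\<rho>\<^sup>2 - t\<^sup>2\<close> on the imaginary one, and only the end
  \<open>t = \<rho>\<close> makes it vanish.\<close>

lemma sl_parameters_eigenvalue:
  assumes "l \<in> sl_parameters \<rho>" "\<rho> > 0"
  obtains s where "s \<ge> 0" "l\<^sup>2 + of_real (\<rho>\<^sup>2) = of_real s" "s = 0 \<longleftrightarrow> l = \<i> * of_real \<rho>"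
proof -
  from assms(1) consider a where "a \<ge> 0" "l = of_real a" | t where "0 \<le> t" "t \<le> \<rho>" "l = \<i> * of_real t"
    unfolding sl_parameters_def by auto
  then show ?thesis
  proof cases
    case 1
    have "a\<^sup>2 + \<rho>\<^sup>2 > 0" using assms(2) by (simp add: add_nonneg_pos)
    moreover have "l \<noteq> \<i> * of_real \<rho>" using 1 assms(2) by (auto simp: complex_eq_iff)
    ultimately show ?thesis using 1 by (intro that[of "a\<^sup>2 + \<rho>\<^sup>2"]) auto
  next
    case 2
    have "t\<^sup>2 \<le> \<rho>\<^sup>2" using 2 by (intro power_mono) auto
    moreover have "\<rho>\<^sup>2 - t\<^sup>2 = 0 \<longleftrightarrow> t = \<rho>" using 2 assms(2)
      by (auto simp: power2_eq_iff)
    moreover have "l = \<i> * of_real \<rho> \<longleftrightarrow> t = \<rho>" using 2 by auto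
    ultimately show ?thesis using 2 by (intro that[of "\<rho>\<^sup>2 - t\<^sup>2"]) (auto simp: power_mult_distrib)
  qed
qed

text \<open>Ensures that a perturbed eigenvalue still belongs to a character; the branch depends on
  the sign of \<open>s - \<rho>\<^sup>2\<close>.\<close>

lemma sl_parameters_surj:
  assumes "s \<ge> 0" "\<rho> > 0"
  obtains l where "l \<in> sl_parameters \<rho>" "l\<^sup>2 + of_real (\<rho>\<^sup>2) = of_real s"
proof (cases "s \<ge> \<rho>\<^sup>2")
  case True
  have "(complex_of_real (sqrt (s - \<rho>\<^sup>2)))\<^sup>2 = of_real (s - \<rho>\<^sup>2)"
    using True by (simp flip: of_real_power del: of_real_diff)
  then show ?thesis
    using True by (intro that[of "of_real (sqrt (s - \<rho>\<^sup>2))"]) (auto simp: sl_parameters_def)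
next
  case False
  have "sqrt (\<rho>\<^sup>2 - s) \<le> \<rho>" using assms by (intro real_le_lsqrt) auto
  moreover have "(complex_of_real (sqrt (\<rho>\<^sup>2 - s)))\<^sup>2 = of_real (\<rho>\<^sup>2 - s)"
    using False by (simp flip: of_real_power del: of_real_diff)
  ultimately show ?thesis
    using False by (intro that[of "\<i> * of_real (sqrt (\<rho>\<^sup>2 - s))"])
      (auto simp: sl_parameters_def power_mult_distrib)
qed

text \<open>The eigenvalue is real, so the real part solves the same equation. Nothing is lost by
  passing to it: the involution is the identity, hence characters are real on the half-line.\<close>

lemma (in sl_coefficient) forced_solution_Re:
  assumes "sl_eigenfunction A \<rho> l \<phi>" "l\<^sup>2 + of_real (\<rho>\<^sup>2) = of_real s"
    and q: "\<And>x. x > 0 \<Longrightarrow> q x = deriv A x / A x"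
  obtains w' where "forced_solution s (\<lambda>x. 0) (\<lambda>x. Re (\<phi> x)) w'" "Re (\<phi> 0) = 1"
proof -
  from assms(1) obtain \<phi>' \<phi>'' where phi: "\<phi> 0 = 1" "\<phi>' 0 = 0"
    "\<And>x. x \<ge> 0 \<Longrightarrow> (\<phi> has_vector_derivative \<phi>' x) (at x within {0..})"
    "\<And>x. x > 0 \<Longrightarrow> (\<phi>' has_vector_derivative \<phi>'' x) (at x)"
    "\<And>x. x > 0 \<Longrightarrow> \<phi>'' x + of_real (deriv A x / A x) * \<phi>' x = - (l\<^sup>2 + of_real (\<rho>\<^sup>2)) * \<phi> x"
    unfolding sl_eigenfunction_def by auto
  have ode: "Re (\<phi>'' x) = 0 - s * Re (\<phi> x) - q x * Re (\<phi>' x)" if x: "x > 0" for x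
  proof -
    have "\<phi>'' x + of_real (q x) * \<phi>' x = - of_real s * \<phi> x"
      using phi(5)[OF x] unfolding assms(2) q[OF x] .
    then have "Re (\<phi>'' x + of_real (q x) * \<phi>' x) = Re (- of_real s * \<phi> x)" by (rule arg_cong)
    then show ?thesis by simp
  qed
  show ?thesis
  proof (rule that[of "\<lambda>x. Re (\<phi>' x)"])
    show "forced_solution s (\<lambda>x. 0) (\<lambda>x. Re (\<phi> x)) (\<lambda>x. Re (\<phi>' x))"
      unfolding forced_solution_def has_real_derivative_iff_has_vector_derivative
    proof (intro conjI allI impI)
      fix x :: real
      show "((\<lambda>x. Re (\<phi> x)) has_vector_derivative Re (\<phi>' x)) (at x within {0..})" if "x \<ge> 0"
        by (rule bounded_linear.has_vector_derivative[OF bounded_linear_Re phi(3)[OF that]])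
      show "((\<lambda>x. Re (\<phi>' x)) has_vector_derivative 0 - s * Re (\<phi> x) - q x * Re (\<phi>' x)) (at x)" if "x > 0"
        using bounded_linear.has_vector_derivative[OF bounded_linear_Re phi(4)[OF that]]
        by (simp only: ode[OF that])
    qed (simp add: phi)
  qed (simp add: phi)
qed

lemma (in sl_coefficient) sl_eigenfunction_of_real:
  assumes sol: "forced_solution s (\<lambda>x. 0) v v'" and "v 0 = 1" and l: "l\<^sup>2 + of_real (\<rho>\<^sup>2) = of_real s"
    and q: "\<And>x. x > 0 \<Longrightarrow> q x = deriv A x / A x"
  shows "sl_eigenfunction A \<rho> l (\<lambda>x. complex_of_real (v x))"
proof -
  let ?v1 = "\<lambda>x. complex_of_real (v' x)"
  let ?v2 = "\<lambda>x. complex_of_real (0 - s * v x - q x * v' x)"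
  have "((\<lambda>x. complex_of_real (v x)) has_vector_derivative ?v1 x) (at x within {0..})" if "x \<ge> 0" for x
    using sol that by (intro has_vector_derivative_of_real) (auto simp: forced_solution_def)
  moreover have "(?v1 has_vector_derivative ?v2 x) (at x)" if "x > 0" for x
    using forced_solution_DERIV(2)[OF sol that] by (intro has_vector_derivative_of_real) auto
  moreover have "?v2 x + complex_of_real (deriv A x / A x) * ?v1 x
      = - (l\<^sup>2 + complex_of_real (\<rho>\<^sup>2)) * complex_of_real (v x)" if "x > 0" for x
    unfolding l q[OF that, symmetric] by (simp add: algebra_simps)
  moreover have "complex_of_real (v 0) = 1" "?v1 0 = 0"
    using assms by (auto simp: forced_solution_def)
  ultimately show ?thesis
    unfolding sl_eigenfunction_def
    by - (rule conjI, assumption, rule exI[of _ ?v1], rule exI[of _ ?v2], intro conjI, simp_all only:, simp_all)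
qed

section \<open>Bounded functionals and bounds for characters\<close>

lemma Linf_normI:
  assumes "f \<in> borel_measurable M" "AE x in M. cmod (f x) \<le> b"
  shows "Linf_norm M f \<le> ereal b" "f \<in> Linf M"
proof -
  show "Linf_norm M f \<le> ereal b"
    unfolding Linf_norm_def using assms by (intro esssup_I) auto
  then show "f \<in> Linf M" using assms by (auto simp: Linf_def intro: le_less_trans)
qed

lemma Linf_functional_bound:
  assumes m: "Linf_functional M m" and M: "emeasure M (space M) \<noteq> 0"
  obtains C where "C \<ge> 0"
    "\<And>f b. f \<in> borel_measurable M \<Longrightarrow> AE x in M. cmod (f x) \<le> b \<Longrightarrow> cmod (m f) \<le> C * b"
proof -
  from m obtain C where C: "\<And>f. f \<in> Linf M \<Longrightarrow> ereal (cmod (m f)) \<le> ereal C * Linf_norm M f"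
    unfolding Linf_functional_def by blast
  show ?thesis
  proof (rule that[of "\<bar>C\<bar>"])
    fix f b assume f: "f \<in> borel_measurable M" "AE x in M. cmod (f x) \<le> b"
    \<comment> \<open>For a null measure the essential supremum would be minus infinity; nonnullity
      makes the norm nonnegative, so that \<open>C\<close> may be replaced by its absolute
      value.\<close>
    have "esssup M (\<lambda>x. 0 :: ereal) \<le> Linf_norm M f"
      unfolding Linf_norm_def by (rule esssup_mono) auto
    then have 0: "0 \<le> Linf_norm M f" using esssup_const[OF M, of "0 :: ereal"] by simp
    have "ereal (cmod (m f)) \<le> ereal C * Linf_norm M f"
      by (intro C Linf_normI(2)[OF f])
    also have "\<dots> \<le> ereal \<bar>C\<bar> * Linf_norm M f"
      using 0 by (intro ereal_mult_right_mono) auto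
    also have "\<dots> \<le> ereal \<bar>C\<bar> * ereal b"
      by (intro ereal_mult_left_mono Linf_normI[OF f]) auto
    finally show "cmod (m f) \<le> \<bar>C\<bar> * b" by simp
  qed simp
qed

text \<open>Multiplicativity on the diagonal writes \<open>(\<alpha> y)\<^sup>2\<close> as an
  average of \<alpha>, so the supremum \<open>S\<close> of |\<alpha>| satisfies
  \<open>S\<^sup>2 \<le> S\<close>.\<close>

lemma character_le_1:
  assumes \<alpha>: "hypergroup_character K \<omega> invo \<alpha>"
    and prob: "\<And>x y. x \<in> K \<Longrightarrow> y \<in> K \<Longrightarrow> prob_space (\<omega> x y)"
    and space: "\<And>x y. x \<in> K \<Longrightarrow> y \<in> K \<Longrightarrow> space (\<omega> x y) = K"
    and x: "x \<in> K"
  shows "cmod (\<alpha> x) \<le> 1"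
proof -
  from \<alpha> have "bounded (\<alpha> ` K)" by (simp add: hypergroup_character_def)
  then obtain B where "\<And>y. y \<in> K \<Longrightarrow> cmod (\<alpha> y) \<le> B" by (auto simp: bounded_iff)
  then have bdd: "bdd_above ((\<lambda>y. cmod (\<alpha> y)) ` K)" by (intro bdd_aboveI2)
  define S where "S = (SUP y\<in>K. cmod (\<alpha> y))"
  have S: "cmod (\<alpha> y) \<le> S" if "y \<in> K" for y
    unfolding S_def by (rule cSUP_upper[OF that bdd])
  have S0: "0 \<le> S" using S[OF x] norm_ge_zero order_trans by blast
  have "(cmod (\<alpha> y))\<^sup>2 \<le> S" if y: "y \<in> K" for y
  proof -
    interpret P: prob_space "\<omega> y y" by (rule prob[OF y y])
    \<comment> \<open>A non-integrable function has integral 0 by convention, so that case satisfies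
      the bound as well.\<close>
    have "cmod (LINT t|\<omega> y y. \<alpha> t) \<le> S"
    proof (cases "integrable (\<omega> y y) \<alpha>")
      case True
      have "cmod (LINT t|\<omega> y y. \<alpha> t) \<le> (LINT t|\<omega> y y. cmod (\<alpha> t))"
        by (rule integral_norm_bound)
      also have "\<dots> \<le> S"
        using True S space[OF y y] by (intro P.integral_le_const) (auto intro!: AE_I2)
      finally show ?thesis .
    qed (simp add: not_integrable_integral_eq S0)
    then show ?thesis
      using \<alpha> y by (simp add: hypergroup_character_def norm_mult power2_eq_square)
  qed
  then have "cmod (\<alpha> y) \<le> sqrt S" if "y \<in> K" for y
    using that by (intro real_le_rsqrt) auto
  then have "S \<le> sqrt S" unfolding S_def[abs_def] using x by (intro cSUP_least) (auto simp: S_def)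
  then have "S\<^sup>2 \<le> (sqrt S)\<^sup>2" using S0 by (intro power_mono)
  then have "S * S \<le> S * 1" using S0 by (simp add: power2_eq_square)
  then have "S \<le> 1" using S0 by (cases "S = 0") auto
  then show ?thesis using S[OF x] by linarith
qed


text \<open>Separates eigenfunctions of different eigenvalues: if their difference vanished, so
  would its derivatives, and the equation would force the right-hand side to vanish too.\<close>

lemma (in sl_coefficient) forced_solution_unique_zero:
  assumes sol: "forced_solution s F w w'" and w: "\<And>x. x \<ge> 0 \<Longrightarrow> w x = 0" and x: "x > 0"
  shows "F x = 0"
proof -
  have w'0: "w' y = 0" if y: "y > 0" for y
  proof (rule DERIV_unique)
    show "(w has_real_derivative w' y) (at y)" by (rule forced_solution_DERIV[OF sol y])
    show "(w has_real_derivative 0) (at y)"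
      by (rule has_field_derivative_transform_within_open[OF DERIV_const[of 0], of "{0<..}"])
        (use y w in auto)
  qed
  have "F x - s * w x - q x * w' x = 0"
  proof (rule DERIV_unique)
    show "(w' has_real_derivative F x - s * w x - q x * w' x) (at x)"
      by (rule forced_solution_DERIV[OF sol x])
    show "(w' has_real_derivative 0) (at x)"
      by (rule has_field_derivative_transform_within_open[OF DERIV_const[of 0], of "{0<..}"])
        (use x w'0 in auto)
  qed
  then show ?thesis using w x w'0 by simp
qed

lemma (in sl_coefficient) forced_solution_diff:
  assumes "forced_solution s (\<lambda>x. 0) u u'" "forced_solution t (\<lambda>x. 0) v v'"
  shows "forced_solution s (\<lambda>x. (t - s) * v x) (\<lambda>x. u x - v x) (\<lambda>x. u' x - v' x)"
  unfolding forced_solution_def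
proof (intro conjI allI impI)
  note * = assms[unfolded forced_solution_def]
  fix x :: real
  show "((\<lambda>x. u x - v x) has_real_derivative u' x - v' x) (at x within {0..})" if "x \<ge> 0"
    using * that by (intro DERIV_diff) auto
  have eq: "(t - s) * v x - s * (u x - v x) - q x * (u' x - v' x)
      = (0 - s * u x - q x * u' x) - (0 - t * v x - q x * v' x)"
    by (simp add: algebra_simps)
  show "((\<lambda>x. u' x - v' x) has_real_derivative (t - s) * v x - s * (u x - v x) - q x * (u' x - v' x)) (at x)"
    if "x > 0"
    unfolding eq using * that by (intro DERIV_diff) blast+
qed (use assms in \<open>auto simp: forced_solution_def\<close>)

lemma sets_sl_measure [measurable_cong, simp]: "sets (sl_measure A) = sets (restrict_space borel {0..})"
  by (simp add: sl_measure_def sets_restrict_space)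

lemma space_sl_measure [simp]: "space (sl_measure A) = {0..}"
  by (simp add: sl_measure_def space_restrict_space)

lemma sl_not_amenable:
  assumes A: "sturm_liouville_function A"
    and lim: "((\<lambda>x. deriv A x / (2 * A x)) \<longlongrightarrow> \<rho>) at_top" and \<rho>: "\<rho> > 0"
    and hyp: "sturm_liouville_hypergroup A \<rho> \<omega>"
    and l: "l \<in> sl_parameters \<rho>" and phi: "sl_eigenfunction A \<rho> l \<phi>"
    and ne: "l \<noteq> \<i> * complex_of_real \<rho>"
  shows "\<not> hypergroup_amenable {0..} \<omega> (sl_measure A) \<phi>"
proof
  assume "hypergroup_amenable {0..} \<omega> (sl_measure A) \<phi>"
  then obtain m where m: "Linf_functional (sl_measure A) m" "m \<phi> = 1"
    and inv: "\<And>f x. f \<in> Linf (sl_measure A) \<Longrightarrow> x \<ge> 0 \<Longrightarrow> m (translation \<omega> x f) = \<phi> x * m f"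
    unfolding hypergroup_amenable_def by auto
  obtain c where "sl_coefficient A (\<lambda>x. deriv A x / A x) c"
    by (rule sl_coefficient_exists[OF A lim \<rho>])
  then interpret sl_coefficient A "\<lambda>x. deriv A x / A x" c .
  from hyp interpret H: commutative_hypergroup "{0..}" \<omega> 0 "\<lambda>x. x"
    by (simp add: sturm_liouville_hypergroup_def)
  have char: "hypergroup_character {0..} \<omega> (\<lambda>x. x) \<alpha>"
    if "k \<in> sl_parameters \<rho>" "sl_eigenfunction A \<rho> k \<alpha>" for k \<alpha>
    using hyp that unfolding sturm_liouville_hypergroup_def by blast
  have space: "space (\<omega> x y) = {0..}" if "x \<in> {0..}" "y \<in> {0..}" for x y
    using sets_eq_imp_space_eq[OF H.sets_conv[OF that]] by (simp add: space_restrict_space)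
  have char_le: "cmod (\<alpha> x) \<le> 1" if "hypergroup_character {0..} \<omega> (\<lambda>x. x) \<alpha>" "x \<ge> 0" for \<alpha> x
    using character_le_1[OF that(1) H.prob space, of x] that(2) by auto
  have char_meas: "\<alpha> \<in> borel_measurable (sl_measure A)"
    if "hypergroup_character {0..} \<omega> (\<lambda>x. x) \<alpha>" for \<alpha>
    using that borel_measurable_continuous_on_restrict[of "{0..}" \<alpha>]
    by (simp add: hypergroup_character_def cong: measurable_cong_sets)
  have "emeasure (sl_measure A) (space (sl_measure A)) \<noteq> 0"
    using hyp by (simp add: sturm_liouville_hypergroup_def hypergroup_haar_def)
  from Linf_functional_bound[OF m(1) this] obtain C where C: "C \<ge> 0"
    "\<And>f b. f \<in> borel_measurable (sl_measure A) \<Longrightarrow> AE x in sl_measure A. cmod (f x) \<le> b \<Longrightarrow> cmod (m f) \<le> C * b"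
    by blast
  have add: "m (\<lambda>x. f x + g x) = m f + m g" if "f \<in> Linf (sl_measure A)" "g \<in> Linf (sl_measure A)" for f g
    using m(1) that unfolding Linf_functional_def by blast
  have cmult: "m (\<lambda>x. a * f x) = a * m f" if "f \<in> Linf (sl_measure A)" for f a
    using m(1) that unfolding Linf_functional_def by blast

  obtain s where s: "s \<ge> 0" "l\<^sup>2 + of_real (\<rho>\<^sup>2) = of_real s" "s = 0 \<longleftrightarrow> l = \<i> * of_real \<rho>"
    by (rule sl_parameters_eigenvalue[OF l \<rho>])
  then have s0: "s > 0" using ne by auto
  have q: "((\<lambda>x. deriv A x / A x) \<longlongrightarrow> 2 * \<rho>) at_top"
    using tendsto_mult[OF tendsto_const[of 2] lim] by (simp add: field_simps)
  obtain D where D: "D > 0"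
    "\<And>F w w' d x. forced_solution s F w w' \<Longrightarrow> (\<And>x. x > 0 \<Longrightarrow> \<bar>F x\<bar> \<le> d) \<Longrightarrow> w 0 = 0 \<Longrightarrow>
       x \<ge> 0 \<Longrightarrow> d \<ge> 0 \<Longrightarrow> \<bar>w x\<bar> \<le> D * d"
    by (rule forced_bound[OF s0 \<rho> q]) blast
  \<comment> \<open>One perturbed eigenvalue replaces the limit: with this \<delta> the final
    estimate \<open>C * (D * \<delta>)\<close> is below 1. Moving upwards from \<open>s\<close>
    keeps the eigenvalue nonnegative.\<close>
  define \<delta> where "\<delta> = 1 / (2 * (C * D + 1))"
  have CD: "C * D + 1 > 0" using C(1) D(1) by (simp add: add_nonneg_pos)
  then have \<delta>: "\<delta> > 0" by (simp add: \<delta>_def)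
  obtain w' where phi': "forced_solution s (\<lambda>x. 0) (\<lambda>x. Re (\<phi> x)) w'" "Re (\<phi> 0) = 1"
    by (rule forced_solution_Re[OF phi s(2)]) auto
  obtain v where v: "continuous_on {0..} v" "v 0 = 1"
      "forced_solution (s + \<delta>) (\<lambda>x. 0) v (\<lambda>x. - (s + \<delta>) * flux v x)"
    by (rule eigenfunction_exists)
  obtain k where k: "k \<in> sl_parameters \<rho>" "k\<^sup>2 + of_real (\<rho>\<^sup>2) = of_real (s + \<delta>)"
    using s0 \<delta> \<rho> by (auto intro: sl_parameters_surj[of "s + \<delta>" \<rho>])
  define \<psi> where "\<psi> = (\<lambda>x. complex_of_real (v x))"
  have psi: "sl_eigenfunction A \<rho> k \<psi>"
    unfolding \<psi>_def by (rule sl_eigenfunction_of_real[OF v(3) v(2) k(2)]) simp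
  note cphi = char[OF l phi] and cpsi = char[OF k(1) psi]
  have real_phi: "complex_of_real (Re (\<phi> x)) = \<phi> x" if "x \<ge> 0" for x
    using cphi that by (simp add: hypergroup_character_def complex_eq_iff)
  have sol: "forced_solution s (\<lambda>x. \<delta> * v x) (\<lambda>x. Re (\<phi> x) - v x) (\<lambda>x. w' x - (- (s + \<delta>) * flux v x))"
    using forced_solution_diff[OF phi'(1) v(3)] by simp
  have close: "cmod (\<phi> x - \<psi> x) \<le> D * \<delta>" if x: "x \<ge> 0" for x
  proof -
    have "\<bar>Re (\<phi> x) - v x\<bar> \<le> D * \<delta>"
    proof (rule D(2)[OF sol _ _ x])
      \<comment> \<open>The perturbed eigenfunction is itself a character, hence bounded by
        1.\<close>
      show "\<bar>\<delta> * v y\<bar> \<le> \<delta>" if "y > 0" for y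
        using char_le[OF cpsi, of y] that \<delta> by (simp add: \<psi>_def abs_mult)
    qed (use phi' v \<delta> in auto)
    moreover have "\<phi> x - \<psi> x = of_real (Re (\<phi> x) - v x)"
      using real_phi[OF x] by (simp add: \<psi>_def)
    ultimately show ?thesis by (simp only: norm_of_real)
  qed
  have Linf: "\<alpha> \<in> Linf (sl_measure A)" if "hypergroup_character {0..} \<omega> (\<lambda>x. x) \<alpha>" for \<alpha>
    by (rule Linf_normI[OF char_meas[OF that], of 1]) (use char_le[OF that] in auto)
  have "\<exists>x\<ge>0. \<phi> x \<noteq> \<psi> x"
  proof (rule ccontr)
    assume "\<not> ?thesis"
    then have "Re (\<phi> x) - v x = 0" if "x \<ge> 0" for x using that by (auto simp: \<psi>_def)
    from forced_solution_unique_zero[OF sol this] have "v x = 0" if "x > 0" for x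
      using that \<delta> by auto
    then have ev: "\<forall>\<^sub>F x in at_right 0. v x = 0"
      by (auto simp: eventually_at_right[of 0 1, simplified] intro!: exI[of _ 1])
    have "(v \<longlongrightarrow> v 0) (at_right 0)"
      using v(1) by (auto simp: continuous_on_def intro: tendsto_within_subset[of v _ _ "{0..}"])
    from tendsto_unique[OF _ this tendsto_eventually[OF ev]] have "v 0 = 0" by simp
    then show False using v(2) by simp
  qed
  then obtain x where x: "x \<ge> 0" "\<phi> x \<noteq> \<psi> x" by auto
  have tr: "translation \<omega> x \<psi> y = \<psi> x * \<psi> y" if "y \<ge> 0" for y
    using cpsi x(1) that by (simp add: hypergroup_character_def translation_def)
  have tr_meas: "translation \<omega> x \<psi> \<in> borel_measurable (sl_measure A)"
    using char_meas[OF cpsi] by (subst measurable_cong[where g="\<lambda>y. \<psi> x * \<psi> y"]) (auto simp: tr)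
  \<comment> \<open>The two functions agree only on the half-line, whereas \<open>m\<close> is
    applied to functions on all reals; that \<open>m\<close> ignores the rest follows by bounding it
    on their difference, whose norm bound is 0.\<close>
  have "m (translation \<omega> x \<psi>) = \<psi> x * m \<psi>"
  proof -
    have "translation \<omega> x \<psi> \<in> Linf (sl_measure A)"
      by (rule Linf_normI[OF tr_meas, of "cmod (\<psi> x)"])
        (use char_le[OF cpsi] in \<open>auto simp: tr norm_mult intro!: AE_I2 mult_left_le\<close>)
    moreover have mult: "(\<lambda>y. - \<psi> x * \<psi> y) \<in> Linf (sl_measure A)"
      by (rule Linf_normI[of _ _ "cmod (\<psi> x)"])
        (use char_le[OF cpsi] char_meas[OF cpsi] in \<open>auto simp: norm_mult intro!: AE_I2 mult_left_le\<close>)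
    ultimately have "m (\<lambda>y. translation \<omega> x \<psi> y + (- \<psi> x * \<psi> y)) = m (translation \<omega> x \<psi>) + - \<psi> x * m \<psi>"
      using cmult[OF Linf[OF cpsi], of "- \<psi> x"] by (subst add) auto
    moreover have "cmod (m (\<lambda>y. translation \<omega> x \<psi> y + (- \<psi> x * \<psi> y))) \<le> C * 0"
      by (rule C(2)) (use tr_meas char_meas[OF cpsi] in \<open>auto simp: tr intro!: AE_I2\<close>)
    ultimately show ?thesis by (simp add: add_eq_0_iff)
  qed
  with inv[OF Linf[OF cpsi] x(1)] x(2) have m0: "m \<psi> = 0" by simp
  have "m (\<lambda>y. \<phi> y + - 1 * \<psi> y) = m \<phi> + - 1 * m \<psi>"
    using cmult[OF Linf[OF cpsi], of "- 1"]
    by (subst add) (use Linf[OF cphi] Linf[OF cpsi] in \<open>auto simp: Linf_def Linf_norm_def\<close>)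
  then have "1 = cmod (m (\<lambda>y. \<phi> y + - 1 * \<psi> y))" using m(2) m0 by simp
  also have "\<dots> \<le> C * (D * \<delta>)"
    by (rule C(2)) (use close char_meas[OF cphi] char_meas[OF cpsi] in \<open>auto intro!: AE_I2\<close>)
  also have "\<dots> < 1"
  proof -
    have "C * D \<ge> 0" using C(1) D(1) by simp
    moreover have "y < 2 * (y + 1)" if "y \<ge> 0" for y :: real using that by simp
    ultimately have "C * D < 2 * (C * D + 1)" by blast
    then show ?thesis using CD by (simp add: \<delta>_def field_simps)
  qed
  finally show False by simp
qed

section \<open>Convolution on the half-line as a Markov kernel\<close>

text \<open>Continuous functions increasing with \<open>n\<close> to the indicator of
  \<open>{..<a}\<close>. On the half-line they are bounded and vanish outside the compact
  \<open>{0..a}\<close>, so they are admissible in the continuity and associativity axioms and in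
  Haar invariance alike.\<close>

definition ramp :: "real \<Rightarrow> nat \<Rightarrow> real \<Rightarrow> real" where
  "ramp a n t = min 1 (max 0 (real n * (a - t)))"

lemma ramp_bounds: "0 \<le> ramp a n t" "ramp a n t \<le> 1"
  by (auto simp: ramp_def)

lemma continuous_ramp: "continuous_on S (ramp a n)"
  unfolding ramp_def by (intro continuous_intros)

lemma measurable_ramp [measurable]: "ramp a n \<in> borel_measurable (restrict_space borel S)"
  by (intro borel_measurable_continuous_on_restrict continuous_ramp)

lemma ramp_eq_0: "a \<le> t \<Longrightarrow> ramp a n t = 0"
  using mult_nonneg_nonpos[of "real n" "a - t"] by (simp add: ramp_def)

lemma SUP_ramp: "(SUP n. ennreal (ramp a n t)) = indicator {..<a} t"
proof (cases "t < a")
  case True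
  obtain n where n: "1 / (a - t) \<le> real n" using real_arch_simple by blast
  have "1 = 1 / (a - t) * (a - t)" using True by simp
  also have "\<dots> \<le> real n * (a - t)" using n True by (intro mult_right_mono) auto
  finally have "ramp a n t = 1" by (simp add: ramp_def)
  then have "1 \<le> (SUP n. ennreal (ramp a n t))" by (metis SUP_upper UNIV_I ennreal_1)
  moreover have "(SUP n. ennreal (ramp a n t)) \<le> 1"
    using ramp_bounds by (intro SUP_least) (auto simp: ennreal_le_1)
  ultimately have "(SUP n. ennreal (ramp a n t)) = 1" by (rule antisym[rotated])
  then show ?thesis using True by simp
qed (simp add: ramp_eq_0)

lemma emeasure_SUP_ramp:
  assumes P: "sets P = sets (restrict_space borel {0..})"
  shows "emeasure P {0..<a} = (SUP n. \<integral>\<^sup>+ t. ennreal (ramp a n t) \<partial>P)"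
proof -
  note [measurable_cong] = P
  have sp: "space P = {0..}" using sets_eq_imp_space_eq[OF P] by (simp add: space_restrict_space)
  have "emeasure P {0..<a} = (\<integral>\<^sup>+ t. indicator {0..<a} t \<partial>P)"
    by (subst nn_integral_indicator) (auto simp: P sets_restrict_space_iff)
  also have "\<dots> = (\<integral>\<^sup>+ t. (SUP n. ennreal (ramp a n t)) \<partial>P)"
    by (intro nn_integral_cong) (auto simp: SUP_ramp sp indicator_def)
  also have "\<dots> = (SUP n. \<integral>\<^sup>+ t. ennreal (ramp a n t) \<partial>P)"
  proof (rule nn_integral_monotone_convergence_SUP)
    show "incseq (\<lambda>n t. ennreal (ramp a n t))"
    proof (rule incseq_SucI, rule le_funI)
      fix n t
      show "ennreal (ramp a n t) \<le> ennreal (ramp a (Suc n) t)"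
      proof (cases "a \<le> t")
        case False
        then show ?thesis
          unfolding ramp_def by (intro ennreal_leI min.mono max.mono mult_right_mono order_refl) auto
      qed (simp add: ramp_eq_0)
    qed
  qed measurable
  finally show ?thesis .
qed

lemma sets_half_line: "sets (restrict_space borel {0::real..}) = sigma_sets {0..} (range (\<lambda>a. {0..<a}))"
proof -
  have borel: "sets (borel :: real measure) = sigma_sets UNIV (range lessThan)"
    by (simp add: borel_Iio)
  then have "sets (restrict_space borel {0::real..}) = (\<inter>) {0..} ` sigma_sets UNIV (range lessThan)"
    by (simp add: sets_restrict_space)
  also have "\<dots> = sigma_sets {0..} ((\<inter>) {0..} ` range lessThan)"
    by (rule sigma_sets_Int) (simp_all flip: borel)
  also have "(\<inter>) {0..} ` range lessThan = range (\<lambda>a. {0::real..<a})"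
    by (auto simp: image_image atLeastLessThan_def)
  finally show ?thesis .
qed

lemma Int_stable_half_line: "Int_stable (range (\<lambda>a. {0::real..<a}))"
  by (auto simp: Int_stable_def)

text \<open>Ramps recover the masses of the intervals \<open>{0..<a}\<close>, an intersection-stable
  generator that exhausts the half-line.\<close>

lemma measure_eqI_ramp:
  assumes P: "sets P = sets (restrict_space borel {0..})" and Q: "sets Q = sets (restrict_space borel {0..})"
    and eq: "\<And>a n. (\<integral>\<^sup>+ t. ennreal (ramp a n t) \<partial>P) = (\<integral>\<^sup>+ t. ennreal (ramp a n t) \<partial>Q)"
    and fin: "\<And>a. emeasure P {0..<a} \<noteq> \<infinity>"
  shows "P = Q"
proof (rule measure_eqI_generator_eq[OF Int_stable_half_line, of "{0..}" P Q "\<lambda>i. {0..<real i}"])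
  show "\<And>X. X \<in> range (\<lambda>a. {0::real..<a}) \<Longrightarrow> emeasure P X = emeasure Q X"
    by (auto simp: emeasure_SUP_ramp[OF P] emeasure_SUP_ramp[OF Q] eq)
  show "(\<Union>i. {0..<real i}) = {0..}"
    using reals_Archimedean2 by (auto simp: set_eq_iff)
qed (auto simp: P Q sets_half_line[symmetric] fin[simplified])

locale half_line_hypergroup = commutative_hypergroup "{0::real..}" \<omega> 0 "\<lambda>x. x" for \<omega>
begin

abbreviation "half_borel \<equiv> restrict_space borel {0::real..}"

lemma space_conv: "x \<ge> 0 \<Longrightarrow> y \<ge> 0 \<Longrightarrow> space (\<omega> x y) = {0..}"
  using sets_eq_imp_space_eq[OF sets_conv, of x y] by (simp add: space_restrict_space)

lemma nn_integral_ramp_conv: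
  assumes "x \<ge> 0" "y \<ge> 0"
  shows "(\<integral>\<^sup>+ t. ennreal (ramp a n t) \<partial>\<omega> x y) = ennreal (LINT t|\<omega> x y. ramp a n t)"
proof -
  interpret prob_space "\<omega> x y" using assms by (intro prob) auto
  note [measurable_cong] = sets_conv[of x y]
  have "integrable (\<omega> x y) (ramp a n)"
    using assms ramp_bounds by (intro integrable_const_bound[of _ 1]) auto
  then show ?thesis
    by (intro nn_integral_eq_integral) (auto simp: ramp_bounds)
qed

lemma continuous_translation_ramp:
  assumes "x \<ge> 0"
  shows "continuous_on {0..} (translation \<omega> x (ramp a n))"
proof -
  have "continuous_on ({0..} \<times> {0..}) (\<lambda>(x, y). LINT t|\<omega> x y. ramp a n t)"
    using ramp_bounds by (intro conv_continuous continuous_ramp) (auto simp: bounded_iff intro!: exI[of _ 1])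
  then have "continuous_on {0..} ((\<lambda>(x, y). LINT t|\<omega> x y. ramp a n t) \<circ> (\<lambda>y. (x, y)))"
    using assms by (intro continuous_on_compose continuous_intros) (auto elim: continuous_on_subset)
  then show ?thesis by (simp add: comp_def translation_def[abs_def])
qed

text \<open>The axioms give only weak continuity of the convolution. On a generator measurability
  follows nevertheless, because \<open>\<omega> x y {0..<a}\<close> is a countable supremum of
  functions continuous in \<open>y\<close>.\<close>

lemma kernel_prob:
  assumes x: "x \<ge> 0"
  shows "\<omega> x \<in> half_borel \<rightarrow>\<^sub>M prob_algebra half_borel"
proof (rule measurable_prob_algebra_generated[OF sets_half_line Int_stable_half_line])
  fix S assume "S \<in> range (\<lambda>a. {0::real..<a})"
  then obtain a where S: "S = {0..<a}" by auto
  have "(\<lambda>y. SUP n. ennreal (translation \<omega> x (ramp a n) y)) \<in> borel_measurable half_borel"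
    using borel_measurable_continuous_on_restrict[OF continuous_translation_ramp[OF x]] by measurable
  then show "(\<lambda>y. emeasure (\<omega> x y) S) \<in> borel_measurable half_borel"
    by (rule measurable_cong[THEN iffD1, rotated])
      (use x in \<open>auto simp: space_restrict_space S emeasure_SUP_ramp[OF sets_conv] nn_integral_ramp_conv translation_def\<close>)
next
  fix y assume "y \<in> space half_borel"
  then have y: "y \<ge> 0" by (simp add: space_restrict_space)
  show "prob_space (\<omega> x y)" "sets (\<omega> x y) = sets half_borel"
    using x y by (simp_all add: prob sets_conv)
qed auto

lemma kernel [measurable]: "x \<ge> 0 \<Longrightarrow> \<omega> x \<in> half_borel \<rightarrow>\<^sub>M subprob_algebra half_borel"
  by (rule measurable_prob_algebraD[OF kernel_prob])

text \<open>Rewrites the composition of kernels as the iterated Bochner integral in which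
  associativity is stated.\<close>

lemma nn_integral_ramp_bind:
  assumes "x \<ge> 0" "y \<ge> 0" "z \<ge> 0"
  shows "(\<integral>\<^sup>+ t. ennreal (ramp a n t) \<partial>(\<omega> y z \<bind> \<omega> x)) = ennreal (LINT s|\<omega> y z. LINT t|\<omega> x s. ramp a n t)"
proof -
  note [measurable_cong] = sets_conv[of y z]
  interpret prob_space "\<omega> y z" using assms by (intro prob) auto
  have K: "\<omega> x \<in> \<omega> y z \<rightarrow>\<^sub>M subprob_algebra half_borel"
    using kernel[of x] assms measurable_cong_sets[OF sets_conv refl, of y z] by auto
  have "(\<integral>\<^sup>+ t. ennreal (ramp a n t) \<partial>(\<omega> y z \<bind> \<omega> x)) = (\<integral>\<^sup>+ s. \<integral>\<^sup>+ t. ennreal (ramp a n t) \<partial>\<omega> x s \<partial>\<omega> y z)"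
    by (rule nn_integral_bind[OF _ K]) measurable
  also have "\<dots> = (\<integral>\<^sup>+ s. ennreal (LINT t|\<omega> x s. ramp a n t) \<partial>\<omega> y z)"
    using assms by (intro nn_integral_cong nn_integral_ramp_conv) (auto simp: space_conv)
  also have "\<dots> = ennreal (LINT s|\<omega> y z. LINT t|\<omega> x s. ramp a n t)"
  proof (intro nn_integral_eq_integral AE_I2 Bochner_Integration.integral_nonneg ramp_bounds)
    have b: "\<bar>LINT t|\<omega> x s. ramp a n t\<bar> \<le> 1" if "s \<ge> 0" for s
    proof -
      interpret X: prob_space "\<omega> x s" using assms that by (intro prob) auto
      have "(\<integral>\<^sup>+ t. ennreal (ramp a n t) \<partial>\<omega> x s) \<le> (\<integral>\<^sup>+ t. 1 \<partial>\<omega> x s)"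
        by (intro nn_integral_mono) (auto simp: ramp_bounds ennreal_le_1)
      then have "ennreal (LINT t|\<omega> x s. ramp a n t) \<le> 1"
        using assms that by (simp add: nn_integral_ramp_conv X.emeasure_space_1)
      then show ?thesis
        by (simp add: ennreal_le_1 ramp_bounds Bochner_Integration.integral_nonneg)
    qed
    show "integrable (\<omega> y z) (\<lambda>s. LINT t|\<omega> x s. ramp a n t)"
    proof (rule integrable_const_bound[of _ 1])
      show "(\<lambda>s. LINT t|\<omega> x s. ramp a n t) \<in> borel_measurable (\<omega> y z)"
        using integral_measurable_subprob_algebra[OF measurable_ramp] K by (rule measurable_compose[rotated])
    qed (use b assms in \<open>auto simp: space_conv\<close>)
  qed
  finally show ?thesis .
qed

lemma sets_bind_conv:
  assumes "x \<ge> 0" and N: "sets N = sets half_borel"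
  shows "sets (N \<bind> \<omega> x) = sets half_borel"
proof (rule sets_bind)
  have sp: "space N = {0..}" using sets_eq_imp_space_eq[OF N] by (simp add: space_restrict_space)
  then show "space N \<noteq> {}" by auto
  show "sets (\<omega> x y) = sets half_borel" if "y \<in> space N" for y
    using that sp assms(1) by (intro sets_conv) auto
qed

text \<open>Associativity brings both sides to the convolution of \<open>\<omega> x y\<close>,
  respectively \<open>\<omega> y x\<close>, with \<open>z\<close>, and these two measures
  coincide.\<close>

lemma conv_commute:
  assumes "x \<ge> 0" "y \<ge> 0" "z \<ge> 0"
  shows "\<omega> x z \<bind> \<omega> y = \<omega> y z \<bind> \<omega> x"
proof (rule measure_eqI_ramp)
  show "sets (\<omega> x z \<bind> \<omega> y) = sets half_borel" "sets (\<omega> y z \<bind> \<omega> x) = sets half_borel"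
    using assms by (auto intro!: sets_bind_conv sets_conv)
  have r: "bounded (ramp a n ` {0..})" for a n
    using ramp_bounds by (auto simp: bounded_iff intro!: exI[of _ 1])
  show "(\<integral>\<^sup>+ t. ennreal (ramp a n t) \<partial>(\<omega> x z \<bind> \<omega> y)) = (\<integral>\<^sup>+ t. ennreal (ramp a n t) \<partial>(\<omega> y z \<bind> \<omega> x))" for a n
    using conv_assoc[OF continuous_ramp[of _ a n] r, of x y z] conv_assoc[OF continuous_ramp[of _ a n] r, of y x z]
      assms conv_comm[of x y] by (simp add: nn_integral_ramp_bind)
  have "prob_space (\<omega> x z \<bind> \<omega> y)"
    by (rule prob_space_bind'[OF _ kernel_prob[OF assms(2)]])
      (use assms prob sets_conv in \<open>auto simp: space_prob_algebra\<close>)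
  then interpret prob_space "\<omega> x z \<bind> \<omega> y" .
  show "emeasure (\<omega> x z \<bind> \<omega> y) {0..<a} \<noteq> \<infinity>" for a
    by simp
qed

text \<open>The point where commutativity enters the construction of the mean.\<close>

lemma bind_commute:
  assumes "x \<ge> 0" "y \<ge> 0" and N: "sets N = sets half_borel"
  shows "N \<bind> \<omega> x \<bind> \<omega> y = N \<bind> \<omega> y \<bind> \<omega> x"
proof -
  have K: "\<omega> w \<in> N \<rightarrow>\<^sub>M subprob_algebra half_borel" if "w \<ge> 0" for w
    by (subst measurable_cong_sets[OF N refl]) (rule kernel[OF that])
  have sp: "space N = {0..}" using sets_eq_imp_space_eq[OF N] by (simp add: space_restrict_space)
  have "N \<bind> \<omega> x \<bind> \<omega> y = N \<bind> (\<lambda>z. \<omega> x z \<bind> \<omega> y)"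
    using assms by (intro bind_assoc[OF K kernel])
  also have "\<dots> = N \<bind> (\<lambda>z. \<omega> y z \<bind> \<omega> x)"
    using assms sp by (intro bind_cong refl conv_commute) auto
  also have "\<dots> = N \<bind> \<omega> y \<bind> \<omega> x"
    using assms by (intro bind_assoc[symmetric, OF K kernel])
  finally show ?thesis .
qed

text \<open>
  Invariance is given for Bochner integrals, which are 0 for non-integrable functions; as the
  integral of a ramp is positive, its translate must be integrable.
\<close>

lemma bind_haar:
  assumes haar: "hypergroup_haar {0..} \<omega> M" and pos: "\<And>a. a > 0 \<Longrightarrow> emeasure M {0..<a} \<noteq> 0"
    and x: "x \<ge> 0"
  shows "M \<bind> \<omega> x = M"
proof (rule measure_eqI_ramp[symmetric])
  note haar' = haar[unfolded hypergroup_haar_def]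
  note M = haar'[THEN conjunct1]
    and compact_fin = haar'[THEN conjunct2, THEN conjunct2, THEN conjunct1, rule_format]
    and inv = haar'[THEN conjunct2, THEN conjunct2, THEN conjunct2, rule_format]
  show "sets M = sets half_borel" by (rule M)
  note [measurable_cong] = M
  show "sets (M \<bind> \<omega> x) = sets half_borel" by (rule sets_bind_conv[OF x M])
  have sp: "space M = {0..}" using sets_eq_imp_space_eq[OF M] by (simp add: space_restrict_space)
  have fin: "emeasure M {0..a} < \<infinity>" for a
    by (rule compact_fin) auto
  show "emeasure M {0..<a} \<noteq> \<infinity>" for a
  proof -
    have "emeasure M {0..<a} \<le> emeasure M {0..a}"
      by (rule emeasure_mono) (auto simp: M sets_restrict_space_iff)
    then show ?thesis using fin[of a] by auto
  qed
  fix a n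
  let ?r = "ramp a n"
  have K: "\<omega> x \<in> M \<rightarrow>\<^sub>M subprob_algebra half_borel"
    by (subst measurable_cong_sets[OF M refl]) (rule kernel[OF x])
  have "(\<integral>\<^sup>+ t. ennreal (?r t) \<partial>(M \<bind> \<omega> x)) = (\<integral>\<^sup>+ y. \<integral>\<^sup>+ t. ennreal (?r t) \<partial>\<omega> x y \<partial>M)"
    by (rule nn_integral_bind[OF _ K]) measurable
  also have "\<dots> = (\<integral>\<^sup>+ y. ennreal (translation \<omega> x ?r y) \<partial>M)"
    using x sp by (intro nn_integral_cong) (auto simp: nn_integral_ramp_conv translation_def)
  also have "\<dots> = (\<integral>\<^sup>+ t. ennreal (?r t) \<partial>M)"
  proof (cases "a \<le> 0 \<or> n = 0")
    case True
    then have r0: "?r t = 0" if "t \<ge> 0" for t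
      using that ramp_eq_0[of a t n] by (auto simp: ramp_def[of a 0])
    have "translation \<omega> x ?r y = 0" if "y \<ge> 0" for y
      unfolding translation_def
      using x that r0 by (subst Bochner_Integration.integral_cong[OF refl, where g="\<lambda>_. 0"]) (auto simp: space_conv)
    then show ?thesis using r0 sp by (intro nn_integral_cong) auto
  next
    case False
    have r_int: "integrable M ?r"
    proof (rule integrableI_bounded)
      have "(\<integral>\<^sup>+ t. ennreal (norm (?r t)) \<partial>M) \<le> (\<integral>\<^sup>+ t. indicator {0..a} t \<partial>M)"
        using sp by (intro nn_integral_mono) (auto simp: indicator_def ramp_bounds ramp_eq_0 ennreal_le_1)
      also have "\<dots> < \<infinity>" using fin by (subst nn_integral_indicator) (auto simp: M sets_restrict_space_iff)
      finally show "(\<integral>\<^sup>+ t. ennreal (norm (?r t)) \<partial>M) < \<infinity>" .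
    qed measurable
    have eq: "(LINT y|M. translation \<omega> x ?r y) = (LINT y|M. ?r y)"
      using x by (intro inv conjI continuous_ramp exI[of _ "{0..a}"]) (auto simp: ramp_eq_0)
    have "(LINT y|M. ?r y) \<noteq> 0"
    proof
      assume "(LINT y|M. ?r y) = 0"
      then have "AE y in M. ?r y = 0"
        using integral_nonneg_eq_0_iff_AE[OF r_int] ramp_bounds by auto
      then have "AE y in M. y \<notin> {0..<a}"
        by eventually_elim (use False in \<open>auto simp: ramp_def max_def min_def split: if_splits\<close>)
      then have "emeasure M {0..<a} = 0"
        by (subst AE_iff_measurable[symmetric, where P="\<lambda>y. y \<notin> {0..<a}"]) (use M sp in \<open>auto simp: sets_restrict_space_iff\<close>)
      then show False using pos[of a] False by auto
    qed
    then have T_int: "integrable M (translation \<omega> x ?r)"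
      using eq not_integrable_integral_eq by metis
    have T_nonneg: "translation \<omega> x ?r y \<ge> 0" for y
      unfolding translation_def by (simp add: ramp_bounds Bochner_Integration.integral_nonneg)
    show ?thesis
      using nn_integral_eq_integral[OF T_int] nn_integral_eq_integral[OF r_int] eq T_nonneg ramp_bounds by auto
  qed
  finally show "(\<integral>\<^sup>+ t. ennreal (?r t) \<partial>M) = (\<integral>\<^sup>+ t. ennreal (?r t) \<partial>(M \<bind> \<omega> x))" by simp
qed

end

section \<open>Invariant means\<close>

text \<open>Real and imaginary parts are bounded measurable real functions, for which the integral
  over a composed kernel is iterated.\<close>

lemma integral_bind_complex:
  fixes f :: "'b \<Rightarrow> complex"
  assumes M: "prob_space M" and N: "N \<in> M \<rightarrow>\<^sub>M prob_algebra K"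
    and f: "f \<in> borel_measurable K" and B: "\<And>x. x \<in> space K \<Longrightarrow> cmod (f x) \<le> B"
  shows "(LINT t|(M \<bind> N). f t) = (LINT x|M. LINT t|N x. f t)"
proof -
  interpret M: prob_space M by (rule M)
  note N' = measurable_prob_algebraD[OF N]
  have Nx: "prob_space (N x)" "sets (N x) = sets K" if "x \<in> space M" for x
    using measurable_space[OF N that] by (auto simp: space_prob_algebra)
  have int: "integrable P f" if "prob_space P" "sets P = sets K" for P
  proof -
    interpret prob_space P by fact
    show ?thesis
      using B f by (intro integrable_const_bound[of _ B])
        (auto simp: sets_eq_imp_space_eq[OF that(2)] measurable_cong_sets[OF that(2) refl])
  qed
  have bnd: "cmod (LINT t|N x. f t) \<le> B" if "x \<in> space M" for x
  proof -
    interpret prob_space "N x" using Nx that by auto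
    have "cmod (LINT t|N x. f t) \<le> (LINT t|N x. cmod (f t))" by (rule integral_norm_bound)
    also have "\<dots> \<le> B"
      using int[OF Nx[OF that]] B by (intro integral_le_const)
        (auto simp: sets_eq_imp_space_eq[OF Nx(2)[OF that]])
    finally show ?thesis .
  qed
  have intN: "integrable M (\<lambda>x. LINT t|N x. f t)"
    by (rule M.integrable_const_bound[of _ B])
      (use bnd measurable_compose[OF N' integral_measurable_subprob_algebra[OF f]] in auto)
  have "space M \<noteq> {}" by (rule M.not_empty)
  then have bind: "prob_space (M \<bind> N)" "sets (M \<bind> N) = sets K"
    using Nx by (auto intro!: prob_space_bind'[OF _ N] sets_bind simp: space_prob_algebra M)
  have real: "(LINT t|(M \<bind> N). g (f t)) = (LINT x|M. LINT t|N x. g (f t))"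
    if g: "g \<in> borel_measurable borel" "\<And>z. \<bar>g z\<bar> \<le> cmod z" for g :: "complex \<Rightarrow> real"
  proof (rule integral_bind[OF _ _ N' M.finite_measure, of _ B 1])
    show "(\<lambda>t. g (f t)) \<in> borel_measurable K" using measurable_compose[OF f g(1)] .
    show "\<bar>g (f x)\<bar> \<le> B" if "x \<in> space K" for x using g(2)[of "f x"] B[OF that] by linarith
    show "AE x in M. emeasure (N x) (space (N x)) \<le> ennreal 1"
      using Nx by (intro AE_I2) (simp add: prob_space.emeasure_space_1)
  qed
  show ?thesis
  proof (rule complex_eqI)
    have "Re (LINT t|(M \<bind> N). f t) = (LINT t|(M \<bind> N). Re (f t))"
      using int[OF bind] by simp
    also have "\<dots> = (LINT x|M. LINT t|N x. Re (f t))"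
      by (rule real) (auto simp: abs_Re_le_cmod)
    also have "\<dots> = (LINT x|M. Re (LINT t|N x. f t))"
      using int Nx by (intro Bochner_Integration.integral_cong refl) simp
    also have "\<dots> = Re (LINT x|M. LINT t|N x. f t)" using intN by simp
    finally show "Re (LINT t|(M \<bind> N). f t) = Re (LINT x|M. LINT t|N x. f t)" .
    have "Im (LINT t|(M \<bind> N). f t) = (LINT t|(M \<bind> N). Im (f t))"
      using int[OF bind] by simp
    also have "\<dots> = (LINT x|M. LINT t|N x. Im (f t))"
      by (rule real) (auto simp: abs_Im_le_cmod)
    also have "\<dots> = (LINT x|M. Im (LINT t|N x. f t))"
      using int Nx by (intro Bochner_Integration.integral_cong refl) simp
    also have "\<dots> = Im (LINT x|M. LINT t|N x. f t)" using intN by simp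
    finally show "Im (LINT t|(M \<bind> N). f t) = Im (LINT x|M. LINT t|N x. f t)" .
  qed
qed

section \<open>Densities almost invariant under finitely many points\<close>

locale half_line_haar = half_line_hypergroup \<omega> for \<omega> +
  fixes M :: "real measure"
  assumes sets_M: "sets M = sets half_borel"
    and bind_M: "x \<ge> 0 \<Longrightarrow> M \<bind> \<omega> x = M"
    and M_unit: "emeasure M {0..<1} \<noteq> 0" "emeasure M {0..<1} \<noteq> \<infinity>"
begin

lemma space_M: "space M = {0..}"
  using sets_eq_imp_space_eq[OF sets_M] by (simp add: space_restrict_space)

lemma M_nonnull: "emeasure M (space M) \<noteq> 0"
proof -
  have "emeasure M {0..<1} \<le> emeasure M (space M)"
    by (rule emeasure_mono) (auto simp: space_M sets.top[of M, unfolded space_M])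
  then show ?thesis using M_unit(1) by auto
qed

text \<open>Probability densities with respect to \<open>M\<close>, kept as measures so that
  convolution with a point is \<open>bind\<close>. Absolute continuity makes integration against
  \<open>N\<close> insensitive to the choice of representative.\<close>

definition ac_prob :: "real measure set" where
  "ac_prob = {N. sets N = sets half_borel \<and> prob_space N \<and> absolutely_continuous M N}"

lemma ac_probD:
  assumes "N \<in> ac_prob"
  shows "sets N = sets half_borel" "prob_space N" "absolutely_continuous M N" "space N = {0..}"
    "N \<in> space (prob_algebra half_borel)"
proof -
  show s: "sets N = sets half_borel" "prob_space N" "absolutely_continuous M N"
    using assms by (simp_all add: ac_prob_def)
  show "space N = {0..}"
    using sets_eq_imp_space_eq[OF s(1)] by (simp add: space_restrict_space)
  show "N \<in> space (prob_algebra half_borel)" using s by (simp add: space_prob_algebra)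
qed

lemma ac_prob_AE: "N \<in> ac_prob \<Longrightarrow> AE x in M. P x \<Longrightarrow> AE x in N. P x"
  using absolutely_continuous_AE[of N M P] ac_probD[of N] sets_M by simp

lemma kernel_prob_ac: "N \<in> ac_prob \<Longrightarrow> x \<ge> 0 \<Longrightarrow> \<omega> x \<in> N \<rightarrow>\<^sub>M prob_algebra half_borel"
  by (subst measurable_cong_sets[OF ac_probD(1) refl]) (assumption, rule kernel_prob)

lemma measurable_ac_prob: "N \<in> ac_prob \<Longrightarrow> f \<in> half_borel \<rightarrow>\<^sub>M L \<Longrightarrow> f \<in> N \<rightarrow>\<^sub>M L"
  by (subst measurable_cong_sets[OF ac_probD(1) refl])

lemma ac_prob_ex: "uniform_measure M {0..<1} \<in> ac_prob"
proof -
  have "prob_space (uniform_measure M {0..<1})"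
    using M_unit by (intro prob_space_uniform_measure) auto
  moreover have "absolutely_continuous M (uniform_measure M {0..<1})"
    unfolding uniform_measure_def
  proof (rule absolutely_continuousI_density)
    have [measurable]: "{0..<1} \<in> sets M" by (auto simp: sets_M sets_restrict_space_iff)
    show "(\<lambda>x. indicator {0..<1} x / emeasure M {0..<1}) \<in> borel_measurable M" by measurable
  qed
  ultimately show ?thesis by (simp add: ac_prob_def sets_M)
qed

text \<open>Covers both uses of \<open>bind\<close>: convolution with a point, and finite averages,
  where \<open>P\<close> is a distribution on indices.\<close>

lemma ac_prob_bind:
  assumes P: "prob_space P" and N: "N \<in> P \<rightarrow>\<^sub>M prob_algebra half_borel"
    and null: "\<And>S. S \<in> null_sets M \<Longrightarrow> AE x in P. emeasure (N x) S = 0"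
  shows "P \<bind> N \<in> ac_prob"
proof -
  interpret P: prob_space P by (rule P)
  have Nx: "sets (N x) = sets half_borel" if "x \<in> space P" for x
    using measurable_space[OF N that] by (auto simp: space_prob_algebra)
  have s: "sets (P \<bind> N) = sets half_borel"
    by (rule sets_bind[OF Nx P.not_empty])
  have "prob_space (P \<bind> N)"
    by (rule prob_space_bind'[OF _ N]) (simp add: space_prob_algebra P)
  moreover have "absolutely_continuous M (P \<bind> N)"
    unfolding absolutely_continuous_def
  proof
    fix S assume S: "S \<in> null_sets M"
    then have S': "S \<in> sets half_borel" using sets_M by auto
    have "emeasure (P \<bind> N) S = (\<integral>\<^sup>+ x. emeasure (N x) S \<partial>P)"
      by (rule emeasure_bind[OF P.not_empty measurable_prob_algebraD[OF N] S'])
    also have "\<dots> = (\<integral>\<^sup>+ x. 0 \<partial>P)" by (rule nn_integral_cong_AE[OF null[OF S]])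
    finally show "S \<in> null_sets (P \<bind> N)" using S' s by auto
  qed
  ultimately show ?thesis using s by (simp add: ac_prob_def)
qed

text \<open>For a null set \<open>S\<close>, invariance of \<open>M\<close> says that
  \<open>\<omega> x y S\<close> integrates to 0 in \<open>y\<close>; hence it vanishes for almost
  every \<open>y\<close>, and \<open>N\<close> sees nothing of it.\<close>

lemma ac_prob_conv:
  assumes N: "N \<in> ac_prob" and x: "x \<ge> 0"
  shows "N \<bind> \<omega> x \<in> ac_prob"
proof (rule ac_prob_bind[OF ac_probD(2)[OF N] kernel_prob_ac[OF N x]])
  fix S assume S: "S \<in> null_sets M"
  then have S': "S \<in> sets half_borel" using sets_M by auto
  have K: "\<omega> x \<in> M \<rightarrow>\<^sub>M subprob_algebra half_borel"
    by (subst measurable_cong_sets[OF sets_M refl]) (rule kernel[OF x])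
  have "emeasure (M \<bind> \<omega> x) S = (\<integral>\<^sup>+ y. emeasure (\<omega> x y) S \<partial>M)"
    by (rule emeasure_bind[OF _ K S']) (simp add: space_M)
  then have "(\<integral>\<^sup>+ y. emeasure (\<omega> x y) S \<partial>M) = 0" using S bind_M[OF x] by auto
  moreover have "(\<lambda>y. emeasure (\<omega> x y) S) \<in> borel_measurable M"
    using measurable_compose[OF K measurable_emeasure_subprob_algebra[OF S']] .
  ultimately have "AE y in M. emeasure (\<omega> x y) S = 0"
    by (simp add: nn_integral_0_iff_AE)
  then show "AE y in N. emeasure (\<omega> x y) S = 0" by (rule ac_prob_AE[OF N])
qed

text \<open>The bound \<open>2 / n\<close> is what an average over \<open>n\<close> convolution
  powers leaves after telescoping. It is uniform over all test functions, so that a translate may be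
  substituted for one.\<close>

definition almost_invariant :: "nat \<Rightarrow> real \<Rightarrow> real measure \<Rightarrow> bool" where
  "almost_invariant n x N \<longleftrightarrow> (\<forall>f :: real \<Rightarrow> complex. f \<in> borel_measurable half_borel \<longrightarrow>
     (\<forall>t\<ge>0. cmod (f t) \<le> 1) \<longrightarrow> cmod ((LINT t|(N \<bind> \<omega> x). f t) - (LINT t|N. f t)) \<le> 2 / n)"

lemma measurable_translation:
  fixes f :: "real \<Rightarrow> complex"
  assumes "f \<in> borel_measurable half_borel" "x \<ge> 0"
  shows "translation \<omega> x f \<in> borel_measurable half_borel"
  unfolding translation_def[abs_def]
  by (rule measurable_compose[OF kernel[OF assms(2)] integral_measurable_subprob_algebra[OF assms(1)]])

lemma translation_le:
  fixes f :: "real \<Rightarrow> complex"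
  assumes "x \<ge> 0" "y \<ge> 0" "AE t in \<omega> x y. cmod (f t) \<le> B" "B \<ge> 0"
  shows "cmod (translation \<omega> x f y) \<le> B"
proof (cases "integrable (\<omega> x y) f")
  case True
  interpret prob_space "\<omega> x y" using assms by (intro prob) auto
  have "cmod (translation \<omega> x f y) \<le> (LINT t|\<omega> x y. cmod (f t))"
    unfolding translation_def by (rule integral_norm_bound)
  also have "\<dots> \<le> B" using True assms by (intro integral_le_const) auto
  finally show ?thesis .
qed (use assms in \<open>simp add: translation_def not_integrable_integral_eq\<close>)

lemma integral_conv:
  fixes f :: "real \<Rightarrow> complex"
  assumes "N \<in> ac_prob" "x \<ge> 0" "f \<in> borel_measurable half_borel" "\<And>t. t \<ge> 0 \<Longrightarrow> cmod (f t) \<le> B"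
  shows "(LINT t|(N \<bind> \<omega> x). f t) = (LINT y|N. translation \<omega> x f y)"
  unfolding translation_def
  using assms by (intro integral_bind_complex[OF ac_probD(2) kernel_prob_ac, of _ _ _ B])
    (auto simp: space_restrict_space)

text \<open>Once the convolution with \<open>y\<close> is moved past the one with \<open>x\<close>,
  it can be shifted onto the test function, whose translate is again bounded by 1.\<close>

lemma almost_invariant_conv:
  assumes N: "N \<in> ac_prob" and x: "x \<ge> 0" and y: "y \<ge> 0" and good: "almost_invariant n x N"
  shows "almost_invariant n x (N \<bind> \<omega> y)"
  unfolding almost_invariant_def
proof (intro allI impI)
  fix f :: "real \<Rightarrow> complex"
  assume f: "f \<in> borel_measurable half_borel" "\<forall>t\<ge>0. cmod (f t) \<le> 1"
  have "N \<bind> \<omega> y \<bind> \<omega> x = N \<bind> \<omega> x \<bind> \<omega> y"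
    by (rule bind_commute[OF y x ac_probD(1)[OF N]])
  then have "(LINT t|(N \<bind> \<omega> y \<bind> \<omega> x). f t) = (LINT t|(N \<bind> \<omega> x). translation \<omega> y f t)"
    using integral_conv[OF ac_prob_conv[OF N x] y f(1), of 1] f(2) by simp
  moreover have "(LINT t|(N \<bind> \<omega> y). f t) = (LINT t|N. translation \<omega> y f t)"
    using integral_conv[OF N y f(1), of 1] f(2) by simp
  moreover have "\<forall>t\<ge>0. cmod (translation \<omega> y f t) \<le> 1"
    using f(2) y by (auto intro!: translation_le AE_I2 simp: space_conv)
  ultimately show "cmod ((LINT t|(N \<bind> \<omega> y \<bind> \<omega> x). f t) - (LINT t|(N \<bind> \<omega> y). f t)) \<le> 2 / n"
    using good measurable_translation[OF f(1) y] unfolding almost_invariant_def by metis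
qed

text \<open>The average is written as \<open>bind\<close> over the uniform distribution on
  \<open>{..<n}\<close>; convolution then passes inside by associativity of
  \<open>bind\<close>.\<close>

lemma almost_invariant_mixture:
  fixes N :: "nat \<Rightarrow> real measure" and n :: nat
  assumes N: "\<And>k. N k \<in> ac_prob" and n: "n > 0" and x: "x \<ge> 0"
  defines "U \<equiv> measure_pmf (pmf_of_set {..<n})"
  shows "U \<bind> N \<in> ac_prob"
    and "\<And>f :: real \<Rightarrow> complex. f \<in> borel_measurable half_borel \<Longrightarrow> \<forall>t\<ge>0. cmod (f t) \<le> 1 \<Longrightarrow>
      (LINT t|(U \<bind> N). f t) = (\<Sum>k<n. LINT t|N k. f t) / n"
    and "\<And>f :: real \<Rightarrow> complex. f \<in> borel_measurable half_borel \<Longrightarrow> \<forall>t\<ge>0. cmod (f t) \<le> 1 \<Longrightarrow>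
      (LINT t|(U \<bind> N \<bind> \<omega> x). f t) = (\<Sum>k<n. LINT t|(N k \<bind> \<omega> x). f t) / n"
proof -
  have U: "prob_space U" unfolding U_def by (rule prob_space_measure_pmf)
  have meas: "N' \<in> U \<rightarrow>\<^sub>M prob_algebra half_borel" if "\<And>k. N' k \<in> ac_prob" for N' :: "nat \<Rightarrow> real measure"
    using ac_probD(5)[OF that] by (simp add: U_def)
  have null: "emeasure (N' k) S = 0" if "N' k \<in> ac_prob" "S \<in> null_sets M" for N' :: "nat \<Rightarrow> real measure" and k S
    using ac_probD(3)[OF that(1)] that(2) by (auto simp: absolutely_continuous_def)
  show ac: "U \<bind> N \<in> ac_prob"
  proof (rule ac_prob_bind[OF U meas[OF N]])
    fix S assume "S \<in> null_sets M"
    then show "AE k in U. emeasure (N k) S = 0" by (intro AE_I2 null N)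
  qed
  have int: "(LINT t|(U \<bind> N'). f t) = (\<Sum>k<n. LINT t|N' k. f t) / n"
    if "\<And>k. N' k \<in> ac_prob" "f \<in> borel_measurable half_borel" "\<forall>t\<ge>0. cmod (f t) \<le> 1" for N' :: "nat \<Rightarrow> real measure" and f :: "real \<Rightarrow> complex"
  proof -
    have "(LINT t|(U \<bind> N'). f t) = (LINT k|U. LINT t|N' k. f t)"
      using that by (intro integral_bind_complex[OF U meas, of _ _ 1]) (auto simp: space_restrict_space)
    also have "\<dots> = (\<Sum>k<n. LINT t|N' k. f t) / n"
    proof -
      have "{..<n} \<noteq> {}" using n by auto
      then have "(LINT k|U. LINT t|N' k. f t) = (\<Sum>k<n. pmf (pmf_of_set {..<n}) k *\<^sub>R (LINT t|N' k. f t))"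
        unfolding U_def by (intro integral_measure_pmf) (simp_all add: set_pmf_of_set)
      also have "\<dots> = (\<Sum>k<n. (LINT t|N' k. f t) / n)"
        using n by (intro sum.cong refl) (simp add: pmf_of_set \<open>{..<n} \<noteq> {}\<close> scaleR_conv_of_real)
      finally show ?thesis by (simp add: sum_divide_distrib)
    qed
    finally show ?thesis .
  qed
  show "(LINT t|(U \<bind> N). f t) = (\<Sum>k<n. LINT t|N k. f t) / n"
    if "f \<in> borel_measurable half_borel" "\<forall>t\<ge>0. cmod (f t) \<le> 1" for f :: "real \<Rightarrow> complex"
    by (rule int[OF N that])
  have "U \<bind> N \<bind> \<omega> x = U \<bind> (\<lambda>k. N k \<bind> \<omega> x)"
    by (rule bind_assoc[OF measurable_prob_algebraD[OF meas[OF N]] kernel[OF x]])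
  then show "(LINT t|(U \<bind> N \<bind> \<omega> x). f t) = (\<Sum>k<n. LINT t|(N k \<bind> \<omega> x). f t) / n"
    if "f \<in> borel_measurable half_borel" "\<forall>t\<ge>0. cmod (f t) \<le> 1" for f :: "real \<Rightarrow> complex"
    using int[OF ac_prob_conv[OF N x] that] by simp
qed

text \<open>In the induction the new point is handled by averaging its convolution powers. The old
  points stay good, since each power is still almost invariant under them and averaging preserves
  the common bound.\<close>

lemma almost_invariant_ex:
  assumes "finite F" "F \<subseteq> {0..}" and n: "n > 0"
  shows "\<exists>N\<in>ac_prob. \<forall>x\<in>F. almost_invariant n x N"
  using assms(1,2)
proof (induction F)
  case empty
  then show ?case using ac_prob_ex by auto
next
  case (insert x F)
  then obtain N where N: "N \<in> ac_prob" and good: "\<And>y. y \<in> F \<Longrightarrow> almost_invariant n y N" by auto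
  have x: "x \<ge> 0" and F: "\<And>y. y \<in> F \<Longrightarrow> y \<ge> 0" using insert.prems by auto
  define Nk where "Nk k = ((\<lambda>N. N \<bind> \<omega> x) ^^ k) N" for k
  have Nk: "Nk k \<in> ac_prob" for k
    by (induction k) (use N x in \<open>auto simp: Nk_def intro: ac_prob_conv\<close>)
  have Nk_Suc: "Nk (Suc k) = Nk k \<bind> \<omega> x" for k by (simp add: Nk_def)
  have goodk: "almost_invariant n y (Nk k)" if "y \<in> F" for y k
  proof (induction k)
    case 0
    then show ?case using good[OF that] by (simp add: Nk_def)
  next
    case (Suc k)
    then show ?case unfolding Nk_Suc by (intro almost_invariant_conv Nk F that x)
  qed
  note mix = almost_invariant_mixture[OF Nk n]
  let ?N = "measure_pmf (pmf_of_set {..<n}) \<bind> Nk"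
  have "almost_invariant n y ?N" if "y \<in> F" for y
    unfolding almost_invariant_def
  proof (intro allI impI)
    fix f :: "real \<Rightarrow> complex"
    assume f: "f \<in> borel_measurable half_borel" "\<forall>t\<ge>0. cmod (f t) \<le> 1"
    have "(LINT t|(?N \<bind> \<omega> y). f t) - (LINT t|?N. f t)
       = (\<Sum>k<n. (LINT t|(Nk k \<bind> \<omega> y). f t) - (LINT t|Nk k. f t)) / n"
      using mix(2,3)[OF F[OF that] f] by (simp add: sum_subtractf diff_divide_distrib)
    also have "cmod \<dots> \<le> (\<Sum>k<n. 2 / n) / n"
      unfolding norm_divide using goodk[OF that] f n
      by (simp only: norm_of_nat) (intro divide_right_mono sum_norm_le, auto simp: almost_invariant_def)
    also have "\<dots> = 2 / n" using n by simp
    finally show "cmod ((LINT t|(?N \<bind> \<omega> y). f t) - (LINT t|?N. f t)) \<le> 2 / n" .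
  qed
  moreover have "almost_invariant n x ?N"
    unfolding almost_invariant_def
  proof (intro allI impI)
    fix f :: "real \<Rightarrow> complex"
    assume f: "f \<in> borel_measurable half_borel" "\<forall>t\<ge>0. cmod (f t) \<le> 1"
    have le: "cmod (LINT t|Nk k. f t) \<le> 1" for k
    proof -
      interpret prob_space "Nk k" by (rule ac_probD(2)[OF Nk])
      have "cmod (LINT t|Nk k. f t) \<le> (LINT t|Nk k. cmod (f t))" by (rule integral_norm_bound)
      also have "\<dots> \<le> 1"
        using f ac_probD(4)[OF Nk] measurable_ac_prob[OF Nk f(1)]
        by (intro integral_le_const integrable_norm integrable_const_bound[of _ 1]) auto
      finally show ?thesis .
    qed
    have "(LINT t|(?N \<bind> \<omega> x). f t) - (LINT t|?N. f t)
       = (\<Sum>k<n. (LINT t|Nk (Suc k). f t) - (LINT t|Nk k. f t)) / n"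
      using mix(2,3)[OF x f] by (simp add: sum_subtractf diff_divide_distrib Nk_Suc)
    \<comment> \<open>Only the two end terms remain, each of modulus at most 1.\<close>
    also have "\<dots> = ((LINT t|Nk n. f t) - (LINT t|Nk 0. f t)) / n"
      using sum_lessThan_telescope[of "\<lambda>k. LINT t|Nk k. f t" n] by simp
    also have "cmod \<dots> \<le> 2 / n"
      unfolding norm_divide using norm_triangle_ineq4[of "LINT t|Nk n. f t" "LINT t|Nk 0. f t"] le[of n] le[of 0] n
      by (simp only: norm_of_nat) (intro divide_right_mono, auto)
    finally show "cmod ((LINT t|(?N \<bind> \<omega> x). f t) - (LINT t|?N. f t)) \<le> 2 / n" .
  qed
  ultimately show ?case using mix(1)[OF x] by auto
qed

end

section \<open>Compactness and cluster points of functionals\<close>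

text \<open>Tychonoff's theorem for a product of discs. With functionals as bare functions in the
  product topology it plays the role of weak-star compactness.\<close>

lemma compact_cball_product:
  fixes r :: "'i \<Rightarrow> real"
  shows "compact {L :: 'i \<Rightarrow> complex. \<forall>i. cmod (L i) \<le> r i}"
proof -
  have "compactin (product_topology (\<lambda>i. euclidean) UNIV) (PiE UNIV (\<lambda>i. cball (0::complex) (r i)))"
    by (subst compactin_PiE) auto
  then have "compact (PiE UNIV (\<lambda>i. cball (0::complex) (r i)))"
    by (simp add: euclidean_product_topology)
  moreover have "PiE UNIV (\<lambda>i. cball (0::complex) (r i)) = {L. \<forall>i. cmod (L i) \<le> r i}"
    by (auto simp: PiE_def)
  ultimately show ?thesis by simp
qed

lemma tendsto_coordinate: "((\<lambda>L :: 'i \<Rightarrow> 'b::topological_space. L i) \<longlongrightarrow> m i) (nhds m)"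
proof -
  have "continuous_on UNIV (\<lambda>L :: 'i \<Rightarrow> 'b. L i)" by (rule continuous_on_product_coordinates)
  show ?thesis
  proof (rule topological_tendstoI)
    fix S :: "'b set" assume "open S" "m i \<in> S"
    then have "open ((\<lambda>L :: 'i \<Rightarrow> 'b. L i) -` S)" "m \<in> (\<lambda>L. L i) -` S"
      using open_vimage[OF _ \<open>continuous_on UNIV (\<lambda>L :: 'i \<Rightarrow> 'b. L i)\<close>] by auto
    then show "\<forall>\<^sub>F L in nhds m. L i \<in> S"
      unfolding eventually_nhds by (intro exI[of _ "(\<lambda>L. L i) -` S"]) auto
  qed
qed

context half_line_haar
begin

text \<open>
  An essentially bounded representative may be unbounded, and its translate then takes the value 0
  where it is not integrable; almost everywhere it agrees with that of a bounded representative.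
\<close>

lemma Linf_truncate:
  assumes f: "f \<in> borel_measurable M" "AE t in M. cmod (f t) \<le> b" and x: "x \<ge> 0" and b: "b \<ge> 0"
  obtains g where "g \<in> borel_measurable half_borel" "\<And>t. cmod (g t) \<le> b" "AE t in M. f t = g t"
    "AE y in M. translation \<omega> x f y = translation \<omega> x g y"
    "translation \<omega> x f \<in> borel_measurable half_borel"
    "AE y in M. cmod (translation \<omega> x f y) \<le> b"
proof
  define g where "g t = (if cmod (f t) \<le> b then f t else 0)" for t
  have [measurable]: "f \<in> borel_measurable half_borel"
    using f(1) measurable_cong_sets[OF sets_M refl, of "borel :: complex measure"] by simp
  show g [measurable]: "g \<in> borel_measurable half_borel" unfolding g_def[abs_def] by measurable
  show gb: "cmod (g t) \<le> b" for t using b by (simp add: g_def)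
  have fg: "cmod (f t) \<le> b \<Longrightarrow> f t = g t" for t by (simp add: g_def)
  show "AE t in M. f t = g t" using f(2) by eventually_elim (rule fg)
  have K: "\<omega> x \<in> M \<rightarrow>\<^sub>M subprob_algebra half_borel"
    by (subst measurable_cong_sets[OF sets_M refl]) (rule kernel[OF x])
  have "AE t in M \<bind> \<omega> x. cmod (f t) \<le> b" by (subst bind_M[OF x]) (rule f(2))
  then have ae: "AE y in M. AE t in \<omega> x y. cmod (f t) \<le> b"
    by (subst (asm) AE_bind[OF K]) measurable
  show T: "translation \<omega> x f \<in> borel_measurable half_borel"
    by (rule measurable_translation[OF _ x]) measurable
  have *: "translation \<omega> x f y = translation \<omega> x g y"
    if "y \<ge> 0" "AE t in \<omega> x y. cmod (f t) \<le> b" for y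
    unfolding translation_def
  proof (rule integral_cong_AE)
    have s: "sets (\<omega> x y) = sets half_borel" using x that by (intro sets_conv) auto
    show "f \<in> borel_measurable (\<omega> x y)" "g \<in> borel_measurable (\<omega> x y)"
      by (subst measurable_cong_sets[OF s refl], measurable)+
    show "AE t in \<omega> x y. f t = g t" using that(2) by eventually_elim (rule fg)
  qed
  show "AE y in M. translation \<omega> x f y = translation \<omega> x g y"
    using ae AE_space by eventually_elim (auto simp: space_M intro: *)
  show "AE y in M. cmod (translation \<omega> x f y) \<le> b"
    using ae AE_space by eventually_elim (auto simp: space_M intro: translation_le[OF x _ _ b])
qed

lemma ac_prob_integral:
  assumes N: "N \<in> ac_prob" and f: "f \<in> borel_measurable M" "AE t in M. cmod (f t) \<le> b"
  shows "integrable N f" "cmod (LINT t|N. f t) \<le> b"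
proof -
  interpret prob_space N by (rule ac_probD(2)[OF N])
  have ae: "AE t in N. cmod (f t) \<le> b" by (rule ac_prob_AE[OF N f(2)])
  have "f \<in> borel_measurable N"
    using f(1) measurable_cong_sets[OF sets_M refl, of "borel :: complex measure"]
    by (intro measurable_ac_prob[OF N]) simp
  then show i: "integrable N f" using ae by (intro integrable_const_bound)
  have "cmod (LINT t|N. f t) \<le> (LINT t|N. cmod (f t))" by (rule integral_norm_bound)
  also have "\<dots> \<le> b" using i ae by (intro integral_le_const) auto
  finally show "cmod (LINT t|N. f t) \<le> b" .
qed

text \<open>Truncation changes \<open>f\<close> and its translate only on null sets of
  \<open>M\<close>, which \<open>N\<close> does not charge; division by \<open>b\<close> then
  produces a test function bounded by 1.\<close>

lemma almost_invariant_Linf: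
  assumes N: "N \<in> ac_prob" and x: "x \<ge> 0" and good: "almost_invariant n x N"
    and f: "f \<in> borel_measurable M" "AE t in M. cmod (f t) \<le> b" and b: "b > 0"
  shows "cmod ((LINT t|N. translation \<omega> x f t) - (LINT t|N. f t)) \<le> b * (2 / n)"
proof -
  obtain g where trunc: "g \<in> borel_measurable half_borel" "\<And>t. cmod (g t) \<le> b" "AE t in M. f t = g t"
    "AE y in M. translation \<omega> x f y = translation \<omega> x g y"
    "translation \<omega> x f \<in> borel_measurable half_borel"
    "AE y in M. cmod (translation \<omega> x f y) \<le> b"
    by (rule Linf_truncate[OF f x less_imp_le[OF b]]) blast
  have [measurable]: "f \<in> borel_measurable half_borel"
    using f(1) measurable_cong_sets[OF sets_M refl, of "borel :: complex measure"] by simp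
  have "(LINT t|N. translation \<omega> x f t) = (LINT t|N. translation \<omega> x g t)"
    by (intro integral_cong_AE measurable_ac_prob[OF N] trunc(5) measurable_translation[OF trunc(1) x]
        ac_prob_AE[OF N trunc(4)])
  also have "\<dots> = (LINT t|(N \<bind> \<omega> x). g t)"
    by (rule integral_conv[symmetric, OF N x trunc(1) trunc(2)])
  also have "\<dots> = (LINT t|(N \<bind> \<omega> x). of_real b * (g t / of_real b))" using b by simp
  also have "\<dots> = of_real b * (LINT t|(N \<bind> \<omega> x). g t / of_real b)" by (rule integral_mult_right_zero)
  finally have 1: "(LINT t|N. translation \<omega> x f t) = of_real b * (LINT t|(N \<bind> \<omega> x). g t / of_real b)" .
  have "(LINT t|N. f t) = (LINT t|N. g t)"
    by (intro integral_cong_AE measurable_ac_prob[OF N] trunc(1) ac_prob_AE[OF N trunc(3)]) measurable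
  also have "\<dots> = (LINT t|N. of_real b * (g t / of_real b))" using b by simp
  also have "\<dots> = of_real b * (LINT t|N. g t / of_real b)" by (rule integral_mult_right_zero)
  finally have 2: "(LINT t|N. f t) = of_real b * (LINT t|N. g t / of_real b)" .
  have "(\<lambda>t. g t / of_real b) \<in> borel_measurable half_borel" using trunc(1) by measurable
  moreover have "cmod (g t / of_real b) \<le> 1" for t using trunc(2)[of t] b by (simp add: norm_divide)
  ultimately have "cmod ((LINT t|(N \<bind> \<omega> x). g t / of_real b) - (LINT t|N. g t / of_real b)) \<le> 2 / n"
    using good unfolding almost_invariant_def by blast
  then have "b * cmod ((LINT t|(N \<bind> \<omega> x). g t / of_real b) - (LINT t|N. g t / of_real b)) \<le> b * (2 / n)"
    using b by (intro mult_left_mono) auto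
  then show ?thesis
    unfolding 1 2 right_diff_distrib[symmetric] norm_mult norm_of_real abs_of_pos[OF b] .
qed

lemma Linf_norm_real:
  assumes "f \<in> Linf M"
  shows "Linf_norm M f = ereal (real_of_ereal (Linf_norm M f))" "f \<in> borel_measurable M"
    "AE t in M. cmod (f t) \<le> real_of_ereal (Linf_norm M f)" "0 \<le> real_of_ereal (Linf_norm M f)"
proof -
  show "f \<in> borel_measurable M" using assms by (simp add: Linf_def)
  have "esssup M (\<lambda>x. 0 :: ereal) \<le> Linf_norm M f"
    unfolding Linf_norm_def by (rule esssup_mono) auto
  then have 0: "0 \<le> Linf_norm M f" using esssup_const[OF M_nonnull, of "0 :: ereal"] by simp
  moreover have "Linf_norm M f < \<infinity>" using assms by (simp add: Linf_def)
  ultimately show e: "Linf_norm M f = ereal (real_of_ereal (Linf_norm M f))"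
    by (cases "Linf_norm M f") auto
  have "AE t in M. ereal (cmod (f t)) \<le> Linf_norm M f"
    unfolding Linf_norm_def by (rule esssup_AE)
  then show "AE t in M. cmod (f t) \<le> real_of_ereal (Linf_norm M f)"
    by eventually_elim (subst (asm) e, simp)
  show "0 \<le> real_of_ereal (Linf_norm M f)" using 0 by (simp add: real_of_ereal_pos)
qed

text \<open>Linearity and normalisation hold for each averaging functional and invariance holds in
  the limit, so all of them pass to a cluster point. Normalisation is stated for functions equal to
  1 almost everywhere, since a character is prescribed on the half-line only.\<close>

lemma invariant_mean:
  obtains m where "Linf_functional M m"
    "\<And>f. f \<in> borel_measurable M \<Longrightarrow> AE t in M. f t = 1 \<Longrightarrow> m f = 1"
    "\<And>f x. f \<in> Linf M \<Longrightarrow> x \<ge> 0 \<Longrightarrow> m (translation \<omega> x f) = m f"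
proof -
  obtain N where N: "\<And>F n. finite F \<Longrightarrow> F \<subseteq> {0..} \<Longrightarrow> N F n \<in> ac_prob"
    and good: "\<And>F n x. finite F \<Longrightarrow> F \<subseteq> {0..} \<Longrightarrow> x \<in> F \<Longrightarrow> almost_invariant (Suc n) x (N F n)"
  proof -
    have "\<forall>F n. \<exists>N. finite F \<and> F \<subseteq> {0..} \<longrightarrow> N \<in> ac_prob \<and> (\<forall>x\<in>F. almost_invariant (Suc n) x N)"
      using almost_invariant_ex by blast
    then obtain N where "\<forall>F n. finite F \<and> F \<subseteq> {0..} \<longrightarrow> N F n \<in> ac_prob \<and> (\<forall>x\<in>F. almost_invariant (Suc n) x (N F n))"
      by metis
    then show ?thesis by (intro that[of N]) auto
  qed
  \<comment> \<open>The finite set of points grows to contain every point of the half-line while the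
    error independently tends to 0.\<close>
  define \<F> where "\<F> = finite_subsets_at_top {0::real..} \<times>\<^sub>F sequentially"
  \<comment> \<open>The value 0 outside \<open>Linf M\<close> gives each coordinate a bound
    \<open>r f\<close> independent of the index, as the compact product requires.\<close>
  define L where "L i f = (if f \<in> Linf M then LINT t|(N (fst i) (snd i)). f t else 0)" for i f
  define r where "r f = (if f \<in> Linf M then real_of_ereal (Linf_norm M f) else 0)" for f
  define G where "G = filtermap L \<F>"
  have "\<F> \<noteq> bot" by (simp add: \<F>_def prod_filter_eq_bot)
  then have G: "G \<noteq> bot" by (simp add: G_def filtermap_bot_iff)
  have fst: "filterlim fst (finite_subsets_at_top {0..}) \<F>" and snd: "filterlim snd sequentially \<F>"
    unfolding \<F>_def by (rule filterlim_fst, rule filterlim_snd)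
  have "\<forall>\<^sub>F F in finite_subsets_at_top {0::real..}. finite F \<and> F \<subseteq> {0..}"
    by (rule eventually_finite_subsets_at_top_weakI) auto
  from eventually_compose_filterlim[OF this fst]
  have ev: "\<forall>\<^sub>F i in \<F>. N (fst i) (snd i) \<in> ac_prob"
    by eventually_elim (use N in auto)
  have evx: "\<forall>\<^sub>F i in \<F>. almost_invariant (Suc (snd i)) x (N (fst i) (snd i))" if x: "x \<ge> 0" for x
  proof -
    have "\<forall>\<^sub>F F in finite_subsets_at_top {0::real..}. finite F \<and> F \<subseteq> {0..} \<and> x \<in> F"
      unfolding eventually_finite_subsets_at_top by (rule exI[of _ "{x}"]) (use x in auto)
    from eventually_compose_filterlim[OF this fst] show ?thesis
      by eventually_elim (use good in auto)
  qed
  have "\<forall>\<^sub>F i in \<F>. L i \<in> {L. \<forall>f. cmod (L f) \<le> r f}"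
    using ev
  proof eventually_elim
    case (elim i)
    then show ?case
      using ac_prob_integral(2)[OF elim] Linf_norm_real(2,3) by (auto simp: L_def r_def)
  qed
  then have "\<forall>\<^sub>F L in G. L \<in> {L. \<forall>f. cmod (L f) \<le> r f}"
    by (simp add: G_def eventually_filtermap)
  with compact_cball_product[of r] G obtain m where m: "\<And>f. cmod (m f) \<le> r f" "inf (nhds m) G \<noteq> bot"
    unfolding compact_filter by blast
  \<comment> \<open>A cluster point need not be a limit, but the proper filter
    \<open>inf (nhds m) G\<close> refines both sides: along it \<open>D\<close> tends to its limit
    at \<open>m\<close> and also to its limit along the net.\<close>
  have limit: "d = d'" if "(D \<longlongrightarrow> d) (nhds m)" "((\<lambda>i. D (L i)) \<longlongrightarrow> d') \<F>"
    for D :: "((real \<Rightarrow> complex) \<Rightarrow> complex) \<Rightarrow> complex" and d d'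
  proof (rule tendsto_unique[OF m(2)])
    show "(D \<longlongrightarrow> d) (inf (nhds m) G)" by (rule tendsto_mono[OF inf_le1 that(1)])
    have "(D \<longlongrightarrow> d') G" using that(2) by (simp add: G_def filterlim_filtermap)
    then show "(D \<longlongrightarrow> d') (inf (nhds m) G)" by (rule tendsto_mono[OF inf_le2])
  qed
  show ?thesis
  proof (rule that[of m])
    show "Linf_functional M m"
      unfolding Linf_functional_def
    proof (intro conjI ballI allI exI[of _ 1])
      fix f g assume f: "f \<in> Linf M" and g: "g \<in> Linf M"
      note f' = Linf_norm_real[OF f] and g' = Linf_norm_real[OF g]
      have fg: "(\<lambda>x. f x + g x) \<in> Linf M"
      proof (rule Linf_normI)
        show "(\<lambda>x. f x + g x) \<in> borel_measurable M" using f'(2) g'(2) by measurable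
        show "AE x in M. cmod (f x + g x) \<le> real_of_ereal (Linf_norm M f) + real_of_ereal (Linf_norm M g)"
          using f'(3) g'(3) by eventually_elim (rule norm_triangle_mono)
      qed
      have "m (\<lambda>x. f x + g x) - m f - m g = 0"
      proof (rule limit[of "\<lambda>L. L (\<lambda>x. f x + g x) - L f - L g"])
        have "\<forall>\<^sub>F i in \<F>. L i (\<lambda>x. f x + g x) - L i f - L i g = 0"
          using ev
        proof eventually_elim
          case (elim i)
          then show ?case
            using ac_prob_integral(1)[OF elim f'(2,3)] ac_prob_integral(1)[OF elim g'(2,3)] f g fg
            by (simp add: L_def)
        qed
        then show "((\<lambda>i. L i (\<lambda>x. f x + g x) - L i f - L i g) \<longlongrightarrow> 0) \<F>"
          by (rule tendsto_eventually)
      qed (intro tendsto_intros tendsto_coordinate)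
      then show "m (\<lambda>x. f x + g x) = m f + m g" by (simp add: algebra_simps)
    next
      fix c f assume f: "f \<in> Linf M"
      note f' = Linf_norm_real[OF f]
      have cf: "(\<lambda>x. c * f x) \<in> Linf M"
      proof (rule Linf_normI)
        show "(\<lambda>x. c * f x) \<in> borel_measurable M" using f'(2) by measurable
        show "AE x in M. cmod (c * f x) \<le> cmod c * real_of_ereal (Linf_norm M f)"
          using f'(3) by eventually_elim (simp add: norm_mult mult_left_mono)
      qed
      have "m (\<lambda>x. c * f x) - c * m f = 0"
      proof (rule limit[of "\<lambda>L. L (\<lambda>x. c * f x) - c * L f"])
        show "((\<lambda>i. L i (\<lambda>x. c * f x) - c * L i f) \<longlongrightarrow> 0) \<F>"
          using f cf by (simp add: L_def)
      qed (intro tendsto_intros tendsto_coordinate)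
      then show "m (\<lambda>x. c * f x) = c * m f" by simp
    next
      fix f assume f: "f \<in> Linf M"
      then show "ereal (cmod (m f)) \<le> ereal 1 * Linf_norm M f"
        using m(1)[of f] Linf_norm_real(1)[OF f] by (metis r_def ereal_less_eq(3) one_ereal_def mult_1)
    qed
  next
    fix f :: "real \<Rightarrow> complex" assume f: "f \<in> borel_measurable M" "AE t in M. f t = 1"
    have ae: "AE t in M. cmod (f t) \<le> 1" using f(2) by eventually_elim simp
    have fL: "f \<in> Linf M" by (rule Linf_normI[OF f(1) ae])
    show "m f = 1"
    proof (rule limit[of "\<lambda>L. L f"])
      have "\<forall>\<^sub>F i in \<F>. L i f = 1"
        using ev
      proof eventually_elim
        case (elim i)
        interpret prob_space "N (fst i) (snd i)" by (rule ac_probD(2)[OF elim])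
        have "(LINT t|(N (fst i) (snd i)). f t) = (LINT t|(N (fst i) (snd i)). 1)"
          using ac_prob_integral(1)[OF elim f(1) ae] ac_prob_AE[OF elim f(2)]
          by (intro integral_cong_AE) auto
        then show ?case using fL by (simp add: L_def prob_space)
      qed
      then show "((\<lambda>i. L i f) \<longlongrightarrow> 1) \<F>" by (rule tendsto_eventually)
    qed (rule tendsto_coordinate)
  next
    fix f x assume f: "f \<in> Linf M" and x: "x \<ge> (0::real)"
    note f' = Linf_norm_real[OF f]
    \<comment> \<open>The added 1 keeps \<open>b\<close> positive even for null functions, where the
      norm is 0.\<close>
    define b where "b = real_of_ereal (Linf_norm M f) + 1"
    have b: "b > 0" "AE t in M. cmod (f t) \<le> b"
      using f'(4) f'(3) by (auto simp: b_def elim: eventually_mono)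
    have trunc: "translation \<omega> x f \<in> borel_measurable half_borel" "AE y in M. cmod (translation \<omega> x f y) \<le> b"
      by (rule Linf_truncate[OF f'(2) b(2) x less_imp_le[OF b(1)]], assumption)+
    have "translation \<omega> x f \<in> borel_measurable M"
      using trunc(1) measurable_cong_sets[OF sets_M refl, of "borel :: complex measure"] by simp
    from Linf_normI(2)[OF this trunc(2)] have T: "translation \<omega> x f \<in> Linf M" .
    have "m (translation \<omega> x f) - m f = 0"
    proof (rule limit[of "\<lambda>L. L (translation \<omega> x f) - L f"])
      have "\<forall>\<^sub>F i in \<F>. norm (L i (translation \<omega> x f) - L i f) \<le> b * (2 / real (Suc (snd i)))"
        using ev evx[OF x]
      proof eventually_elim
        case (elim i)
        then show ?case
          using almost_invariant_Linf[OF elim(1) x elim(2) f'(2) b(2) b(1)] f T by (simp add: L_def)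
      qed
      moreover have "((\<lambda>i. b * (2 / real (Suc (snd i)))) \<longlongrightarrow> 0) \<F>"
      proof (rule filterlim_compose[OF _ snd])
        have "(\<lambda>n. b * (2 * inverse (real (Suc n)))) \<longlonglongrightarrow> b * (2 * 0)"
          by (intro tendsto_intros LIMSEQ_inverse_real_of_nat)
        then show "(\<lambda>n. b * (2 / real (Suc n))) \<longlonglongrightarrow> 0" by (simp add: divide_inverse)
      qed
      ultimately show "((\<lambda>i. L i (translation \<omega> x f) - L i f) \<longlongrightarrow> 0) \<F>"
        by (rule Lim_null_comparison)
    qed (intro tendsto_intros tendsto_coordinate)
    then show "m (translation \<omega> x f) = m f" by simp
  qed
qed

end

section \<open>The mean on the Sturm-Liouville hypergroup\<close>

text \<open>Gives the nonzero ramp integrals on which Haar invariance of the kernel rests, and the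
  mass of \<open>{0..<1}\<close> needed for a first density.\<close>

lemma sl_measure_pos:
  assumes A: "sturm_liouville_function A" and a: "a > 0"
  shows "emeasure (sl_measure A) {0..<a} \<noteq> 0"
proof
  assume "emeasure (sl_measure A) {0..<a} = 0"
  have cont: "continuous_on {0..} A" and pos: "\<And>x. x > 0 \<Longrightarrow> A x > 0"
    using A by (auto simp: sturm_liouville_function_def)
  have "A \<in> borel_measurable (restrict_space borel {0..})"
    by (rule borel_measurable_continuous_on_restrict[OF cont])
  then have m: "(\<lambda>x. ennreal (A x)) \<in> borel_measurable (restrict_space lborel {0..})"
    by (intro measurable_compose[OF _ measurable_ennreal])
      (simp add: measurable_cong_sets[OF sets_restrict_space_cong[OF sets_lborel] refl])
  have "{0..<a} \<in> null_sets (sl_measure A)"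
    using \<open>emeasure (sl_measure A) {0..<a} = 0\<close>
    by (intro null_setsI) (auto simp: sets_restrict_space_iff)
  then have "AE x in restrict_space lborel {0..}. x \<in> {0..<a} \<longrightarrow> ennreal (A x) = 0"
    unfolding sl_measure_def by (simp add: null_sets_density_iff[OF m])
  then have "AE x in lborel. x \<in> {0..} \<longrightarrow> x \<in> {0..<a} \<longrightarrow> ennreal (A x) = 0"
    by (subst (asm) AE_restrict_space_iff) auto
  then have "AE x in lborel. x \<notin> {0<..<a}"
    by eventually_elim (use pos in \<open>force simp: ennreal_eq_0_iff not_le\<close>)
  then have "emeasure lborel {0<..<a} = 0"
    by (subst AE_iff_measurable[symmetric, where P="\<lambda>x. x \<notin> {0<..<a}"]) auto
  then show False using a by simp
qed

lemma sl_amenable: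
  assumes A: "sturm_liouville_function A"
    and lim: "((\<lambda>x. deriv A x / (2 * A x)) \<longlongrightarrow> \<rho>) at_top" and \<rho>: "\<rho> > 0"
    and hyp: "sturm_liouville_hypergroup A \<rho> \<omega>"
    and phi: "sl_eigenfunction A \<rho> (\<i> * complex_of_real \<rho>) \<phi>"
  shows "hypergroup_amenable {0..} \<omega> (sl_measure A) \<phi>"
proof -
  have l: "\<i> * complex_of_real \<rho> \<in> sl_parameters \<rho>" using \<rho> by (auto simp: sl_parameters_def)
  obtain c where "sl_coefficient A (\<lambda>x. deriv A x / A x) c"
    by (rule sl_coefficient_exists[OF A lim \<rho>])
  then interpret sl_coefficient A "\<lambda>x. deriv A x / A x" c .
  from hyp have haar: "hypergroup_haar {0..} \<omega> (sl_measure A)"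
    and "commutative_hypergroup {0..} \<omega> 0 (\<lambda>x. x)"
    unfolding sturm_liouville_hypergroup_def by (rule conjunct2[THEN conjunct1], rule conjunct1)
  then interpret H: half_line_hypergroup \<omega> by (intro half_line_hypergroup.intro)
  have fin: "emeasure (sl_measure A) {0..1} < \<infinity>"
    by (rule haar[unfolded hypergroup_haar_def, THEN conjunct2, THEN conjunct2, THEN conjunct1, rule_format]) auto
  interpret H: half_line_haar \<omega> "sl_measure A"
  proof unfold_locales
    show "sl_measure A \<bind> \<omega> x = sl_measure A" if "x \<ge> 0" for x
      by (rule H.bind_haar[OF haar sl_measure_pos[OF A] that])
    have "emeasure (sl_measure A) {0..<1} \<le> emeasure (sl_measure A) {0..1}"
      by (rule emeasure_mono) (auto simp: sets_restrict_space_iff)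
    then show "emeasure (sl_measure A) {0..<1} \<noteq> \<infinity>" using fin by auto
    show "emeasure (sl_measure A) {0..<1} \<noteq> 0" by (rule sl_measure_pos[OF A]) simp
  qed simp
  \<comment> \<open>At this parameter the eigenvalue is 0, so \<open>flux_bound\<close> applies with
    \<open>H = 0\<close>: the real part has zero derivative and keeps its initial value 1. The
    imaginary part vanishes because \<phi> is a character.\<close>
  have phi_1: "\<phi> x = 1" if x: "x \<ge> 0" for x
  proof -
    have "(\<i> * complex_of_real \<rho>)\<^sup>2 + of_real (\<rho>\<^sup>2) = of_real 0" by (simp add: power_mult_distrib)
    from forced_solution_Re[OF phi this] obtain w' where w': "forced_solution 0 (\<lambda>x. 0) (\<lambda>x. Re (\<phi> x)) w'" "Re (\<phi> 0) = 1"
      by blast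
    have w'0: "w' y = 0" if "y \<ge> 0" for y
      using flux_bound[of "\<lambda>x. Re (\<phi> x)" w' "\<lambda>x. 0" y 0] w'(1) that
      by (simp add: forced_solution_def)
    have "continuous_on {0..x} (\<lambda>x. Re (\<phi> x))"
      using forced_solution_continuous(1)[OF w'(1), of 0] by (auto intro: continuous_on_subset)
    moreover have "((\<lambda>x. Re (\<phi> x)) has_real_derivative 0) (at y)" if "0 < y" for y
      using forced_solution_DERIV(1)[OF w'(1) that] w'0[of y] that by simp
    ultimately have "Re (\<phi> x) = Re (\<phi> 0)"
      using x DERIV_isconst_end[of 0 x "\<lambda>x. Re (\<phi> x)"] by (cases "x = 0") simp_all
    moreover have "cnj (\<phi> x) = \<phi> x"
    proof -
      have "hypergroup_character {0..} \<omega> (\<lambda>x. x) \<phi>"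
        using hyp l phi unfolding sturm_liouville_hypergroup_def by blast
      then show ?thesis using x by (simp add: hypergroup_character_def)
    qed
    ultimately show ?thesis using w'(2) by (simp add: complex_eq_iff)
  qed
  obtain m where m: "Linf_functional (sl_measure A) m"
    "\<And>f. f \<in> borel_measurable (sl_measure A) \<Longrightarrow> AE t in sl_measure A. f t = 1 \<Longrightarrow> m f = 1"
    "\<And>f x. f \<in> Linf (sl_measure A) \<Longrightarrow> x \<ge> 0 \<Longrightarrow> m (translation \<omega> x f) = m f"
    by (rule H.invariant_mean) blast
  have "\<phi> \<in> borel_measurable (sl_measure A)"
    by (rule measurable_cong[THEN iffD2, of _ _ "\<lambda>_. 1"]) (auto simp: phi_1)
  then have "m \<phi> = 1" by (rule m(2)) (auto simp: phi_1 intro!: AE_I2)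
  then show ?thesis
    unfolding hypergroup_amenable_def using m(1,3) phi_1 by (intro exI[of _ m]) auto
qed

theorem theorem5p3:
  fixes A :: "real \<Rightarrow> real"
    and \<omega> :: "real \<Rightarrow> real \<Rightarrow> real measure"
    and \<rho> :: real
    and l :: complex
    and \<phi> :: "real \<Rightarrow> complex"
  assumes "sturm_liouville_function A"
    and "((\<lambda>x. deriv A x / (2 * A x)) \<longlongrightarrow> \<rho>) at_top"
    and "\<rho> > 0"
    and "sturm_liouville_hypergroup A \<rho> \<omega>"
    and "l \<in> sl_parameters \<rho>"
    and "sl_eigenfunction A \<rho> l \<phi>"
  shows "hypergroup_amenable {0..} \<omega> (sl_measure A) \<phi> \<longleftrightarrow> l = \<i> * complex_of_real \<rho>"
proof
  assume "hypergroup_amenable {0..} \<omega> (sl_measure A) \<phi>"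
  then show "l = \<i> * complex_of_real \<rho>" using sl_not_amenable[OF assms] by blast
next
  assume "l = \<i> * complex_of_real \<rho>"
  then show "hypergroup_amenable {0..} \<omega> (sl_measure A) \<phi>"
    using sl_amenable[OF assms(1-4)] assms(6) by simp
qed

end
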